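(* Let $\vec p=(1,1)$ and $\vec q=(q_1,q_2)\in[1,\infty)^2$, and let $\vec a,\vec b,\vec c\in\mathbb{R}^2$, $\vec\alpha,\vec\beta\in(-1,\infty)^2$. Then the following are equivalent: (1) $S_{\vec a,\vec b,\vec c}$ is bounded from $L^{\vec p}_{\vec\alpha}(T_B\times T_B)$ to $L^{\vec q}_{\vec\beta}(T_B\times T_B)$; (2) $T_{\vec a,\vec b,\vec c}$ is bounded from $L^{\vec p}_{\vec\alpha}(T_B\times T_B)$ to $L^{\vec q}_{\vec\beta}(T_B\times T_B)$; (3) for each $i\in\{1,2\}$: $-q_ia_i<\beta_i+1$, $\alpha_i<b_i$, and $c_i=n+1+a_i+b_i+\lambda_i$, where $\lambda_i=\frac{n+1+\beta_i}{q_i}-(n+1+\alpha_i)$.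
   Context: Let $n$ be a positive integer. For $z=(z_1,\dots,z_n)\in\mathbb{C}^n$ write $z=x+iy$ with $x,y\in\mathbb{R}^n$, $z'=(z_1,\dots,z_{n-1})$, $y'=(y_1,\dots,y_{n-1})$. Let $B=\{y\in\mathbb{R}^n: |y'|^2<y_n\}$ and $T_B=\{x+iy: x\in\mathbb{R}^n, y\in B\}$. For $z\in T_B$ put $\rho(z)=y_n-|y'|^2>0$, and for $z,u\in T_B$ put $\rho(z,u)=\frac14\big(\sum_{j=1}^{n-1}(z_j-\overline{u_j})^2-2i(z_n-\overline{u_n})\big)$; this has positive real part, and complex powers $\rho(z,u)^c$ are taken with the principal branch. $dV$ is Lebesgue measure on $\mathbb{C}^n$ and $dV_\alpha(z)=\rho(z)^\alpha dV(z)$. For $\vec p=(p_1,p_2)\in[1,\infty]^2$ and $\vec\alpha=(\alpha_1,\alpha_2)$, $L^{\vec p}_{\vec\alpha}(T_B\times T_B)$ is the space of measurable $f$ on $T_B\times T_B$ with finite mixed norm $\|f\|_{\vec p,\vec\alpha}=\big\{\int_{T_B}\big(\int_{T_B}|f(z,w)|^{p_1}dV_{\alpha_1}(z)\big)^{p_2/p_1}dV_{\alpha_2}(w)\big\}^{1/p_2}$, with the inner (resp. outer) integral replaced by an essential supremum in $z$ (resp. $w$) when $p_1=\infty$ (resp. $p_2=\infty$); when $\vec p=(\infty,\infty)$ this is $L^\infty(T_B\times T_B)$. Write $p_-=\min\{p_1,p_2\}$, $p_+=\max\{p_1,p_2\}$, and similarly $q_\pm$. For $\vec a=(a_1,a_2),\vec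 b=(b_1,b_2),\vec c=(c_1,c_2)\in\mathbb{R}^2$, $T_{\vec a,\vec b,\vec c}f(z,w)=\rho(z)^{a_1}\rho(w)^{a_2}\int_{T_B}\int_{T_B}\frac{\rho(u)^{b_1}\rho(\eta)^{b_2}}{\rho(z,u)^{c_1}\rho(w,\eta)^{c_2}}f(u,\eta)\,dV(u)\,dV(\eta)$ and $S_{\vec a,\vec b,\vec c}f(z,w)=\rho(z)^{a_1}\rho(w)^{a_2}\int_{T_B}\int_{T_B}\frac{\rho(u)^{b_1}\rho(\eta)^{b_2}}{|\rho(z,u)|^{c_1}|\rho(w,\eta)|^{c_2}}f(u,\eta)\,dV(u)\,dV(\eta)$. An operator is bounded from $X$ to $Y$ if for every $f\in X$ the defining integral converges for a.e. $(z,w)$ and $\|Tf\|_Y\le C\|f\|_X$ with $C$ independent of $f$. *)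

theory Defs
  imports "HOL-Analysis.Analysis"
begin

text \<open>Points of C^n are vectors complex^'n; n = CARD('n). The distinguished index e
plays the role of the last coordinate z_n; the other indices form z'.\<close>

definition rho :: "'n::finite \<Rightarrow> complex^'n \<Rightarrow> real" where
  "rho e z = Im (z $ e) - (\<Sum>i\<in>UNIV - {e}. (Im (z $ i))\<^sup>2)"

definition TB :: "'n::finite \<Rightarrow> (complex^'n) set" where
  "TB e = {z. rho e z > 0}"

definition rho2 :: "'n::finite \<Rightarrow> complex^'n \<Rightarrow> complex^'n \<Rightarrow> complex" where
  "rho2 e z u = (1/4) * ((\<Sum>i\<in>UNIV - {e}. (z $ i - cnj (u $ i))\<^sup>2)
                       - 2 * \<i> * (z $ e - cnj (u $ e)))"

definition enn_powr :: "ennreal \<Rightarrow> real \<Rightarrow> ennreal" where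
  "enn_powr x r = (if x = \<infinity> then \<infinity> else ennreal (enn2real x powr r))"

definition Vw :: "'n::finite \<Rightarrow> real \<Rightarrow> (complex^'n) measure" where
  "Vw e \<alpha> = density (restrict_space lborel (TB e)) (\<lambda>z. ennreal (rho e z powr \<alpha>))"

definition PP :: "'n::finite \<Rightarrow> ((complex^'n) \<times> (complex^'n)) measure" where
  "PP e = restrict_space (lborel \<Otimes>\<^sub>M lborel) (TB e \<times> TB e)"

definition mnorm :: "'n::finite \<Rightarrow> real \<Rightarrow> real \<Rightarrow> real \<Rightarrow> real
    \<Rightarrow> ((complex^'n) \<times> (complex^'n) \<Rightarrow> complex) \<Rightarrow> ennreal" where
  "mnorm e p1 p2 \<alpha>1 \<alpha>2 f =
     enn_powr (\<integral>\<^sup>+ w. enn_powr (\<integral>\<^sup>+ z. ennreal (norm (f (z, w)) powr p1) \<partial>Vw e \<alpha>1) (p2 / p1)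
               \<partial>Vw e \<alpha>2) (1 / p2)"

definition kerT :: "'n::finite \<Rightarrow> real \<Rightarrow> real \<Rightarrow> real \<Rightarrow> real
    \<Rightarrow> (complex^'n) \<times> (complex^'n) \<Rightarrow> (complex^'n) \<times> (complex^'n) \<Rightarrow> complex" where
  "kerT e b1 b2 c1 c2 x y = (case x of (z, w) \<Rightarrow> case y of (u, \<eta>) \<Rightarrow>
     of_real (rho e u powr b1 * rho e \<eta> powr b2) /
     (rho2 e z u powr of_real c1 * rho2 e w \<eta> powr of_real c2))"

definition kerS :: "'n::finite \<Rightarrow> real \<Rightarrow> real \<Rightarrow> real \<Rightarrow> real
    \<Rightarrow> (complex^'n) \<times> (complex^'n) \<Rightarrow> (complex^'n) \<times> (complex^'n) \<Rightarrow> complex" where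
  "kerS e b1 b2 c1 c2 x y = (case x of (z, w) \<Rightarrow> case y of (u, \<eta>) \<Rightarrow>
     of_real (rho e u powr b1 * rho e \<eta> powr b2 /
     (cmod (rho2 e z u) powr c1 * cmod (rho2 e w \<eta>) powr c2)))"

definition intop :: "'n::finite \<Rightarrow> real \<Rightarrow> real
    \<Rightarrow> ((complex^'n) \<times> (complex^'n) \<Rightarrow> (complex^'n) \<times> (complex^'n) \<Rightarrow> complex)
    \<Rightarrow> ((complex^'n) \<times> (complex^'n) \<Rightarrow> complex) \<Rightarrow> (complex^'n) \<times> (complex^'n) \<Rightarrow> complex" where
  "intop e a1 a2 K f x = (case x of (z, w) \<Rightarrow>
     of_real (rho e z powr a1 * rho e w powr a2) * integral\<^sup>L (PP e) (\<lambda>y. K x y * f y))"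

definition inL :: "'n::finite \<Rightarrow> real \<Rightarrow> real \<Rightarrow> real \<Rightarrow> real
    \<Rightarrow> ((complex^'n) \<times> (complex^'n) \<Rightarrow> complex) \<Rightarrow> bool" where
  "inL e p1 p2 \<alpha>1 \<alpha>2 f \<longleftrightarrow>
     f \<in> borel_measurable (PP e) \<and> mnorm e p1 p2 \<alpha>1 \<alpha>2 f < \<infinity>"

definition bounded_op :: "'n::finite \<Rightarrow> real \<Rightarrow> real
    \<Rightarrow> ((complex^'n) \<times> (complex^'n) \<Rightarrow> (complex^'n) \<times> (complex^'n) \<Rightarrow> complex)
    \<Rightarrow> real \<Rightarrow> real \<Rightarrow> real \<Rightarrow> real \<Rightarrow> real \<Rightarrow> real \<Rightarrow> real \<Rightarrow> real \<Rightarrow> bool" where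
  "bounded_op e a1 a2 K p1 p2 \<alpha>1 \<alpha>2 q1 q2 \<beta>1 \<beta>2 \<longleftrightarrow>
     (\<exists>C::real. \<forall>f. inL e p1 p2 \<alpha>1 \<alpha>2 f \<longrightarrow>
        (AE x in PP e. integrable (PP e) (\<lambda>y. K x y * f y)) \<and>
        mnorm e q1 q2 \<beta>1 \<beta>2 (intop e a1 a2 K f) \<le> ennreal C * mnorm e p1 p2 \<alpha>1 \<alpha>2 f)"

end

theory Submission
  imports Defs
begin

text \<open>Both kernels are tensor products and have the same modulus, so everything reduces to the
  one-variable integral of \<open>\<rho>(z)\<^sup>s / |\<rho>(z,u)|\<^sup>t\<close>. A shear of \<open>z\<close> makes the integrand depend on \<open>u\<close> only through
  \<open>\<rho>(u)\<close>, and an anisotropic dilation then shows that the integral is a constant times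
  \<open>\<rho>(u)\<close> to the power \<open>n + 1 + s - t\<close>; the constant is finite iff \<open>s > -1\<close> and \<open>t > n + 1 + s\<close>.
  For sufficiency, Jensen's inequality is applied first with respect to the measure
  \<open>k\<^sub>2(w,\<eta>) |f| dV\<close> and then to \<open>|f| dV\<close>, which replaces Minkowski's inequality in mixed norm.
  For necessity, the operator is tested on indicators of small balls around points \<open>(0, iR)\<close>: there the
  kernel is, uniformly in \<open>(z,w)\<close>, close to its value at the centre, so its mixed norm at the centre is
  bounded by a constant times \<open>R\<^sub>1\<^bsup>\<alpha>1\<^esup> R\<^sub>2\<^bsup>\<alpha>2\<^esup>\<close>. Comparing the degrees in \<open>R\<^sub>1\<close> and \<open>R\<^sub>2\<close> gives the formula for \<open>c\<close>.\<close>

subsection \<open>Powers of extended nonnegative reals and tensor product kernels\<close>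

text \<open>With source exponents (1,1) every function is a superposition of near point masses, so
  boundedness amounts to a uniform bound on the mixed norms of the kernel columns at (u,\<eta>),
  divided by \<rho>(u)^\<alpha>1 \<rho>(\<eta>)^\<alpha>2. Such a norm factors over the two
  variables into powers of \<rho>, and \<rho> takes every positive value, so each exponent must be
  0: this is the equation for c. Once it holds, the convergence condition t > n + 1 + s says exactly
  \<alpha> < b, and s > -1 is the remaining inequality. The obstacle is the oscillation of the
  principal powers. The operator T cannot be bounded below by taking absolute values under the
  integral, and the domain is unbounded, so the kernel has to be close to its value at the centre
  relative to its own size. This works because a change of u alters \<rho>(z,u) by an amount that
  grows no faster in z than |\<rho>(z,u)| does. Norms and constants are kept in
  \<open>ennreal\<close>, so that homogeneity and factorization are available before finiteness is
  known.\<close>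

lemma enn_powr_top [simp]: "enn_powr \<infinity> r = \<infinity>" "enn_powr top r = top"
  by (auto simp: enn_powr_def)

lemma enn_powr_ennreal: "0 \<le> x \<Longrightarrow> enn_powr (ennreal x) r = ennreal (x powr r)"
  by (simp add: enn_powr_def)

lemma enn_powr_0 [simp]: "enn_powr 0 r = 0"
  by (simp add: enn_powr_def)

lemma enn_powr_one_right [simp]: "enn_powr x 1 = x"
  by (cases x) (auto simp: enn_powr_def)

lemma enn_powr_eq_top_iff [simp]: "enn_powr x r = \<infinity> \<longleftrightarrow> x = \<infinity>" "enn_powr x r = top \<longleftrightarrow> x = top"
  by (auto simp: enn_powr_def)

lemma enn_powr_eq_0_iff [simp]: "enn_powr x r = 0 \<longleftrightarrow> x = 0"
  by (cases x) (auto simp: enn_powr_def ennreal_eq_0_iff enn2real_eq_0_iff)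

lemma enn_powr_mono: "x \<le> y \<Longrightarrow> 0 \<le> r \<Longrightarrow> enn_powr x r \<le> enn_powr y r"
  by (cases x; cases y) (auto simp: enn_powr_ennreal top_unique intro!: ennreal_leI powr_mono2)

text \<open>Valid for every real \<open>r\<close>, negative ones included: each power fixes both 0
  and top, and 0 * top = 0, so the degenerate cases agree.\<close>

lemma enn_powr_mult: "enn_powr (x * y) r = enn_powr x r * enn_powr y r"
proof -
  have "enn_powr (ennreal u * ennreal v) r = enn_powr (ennreal u) r * enn_powr (ennreal v) r"
    if "0 \<le> u" "0 \<le> v" for u v
    using that by (simp add: enn_powr_ennreal powr_mult flip: ennreal_mult)
  then show ?thesis
    by (cases x; cases y) (auto simp: ennreal_mult_top ennreal_top_mult enn_powr_ennreal)
qed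

lemma enn_powr_powr: "enn_powr (enn_powr x r) s = enn_powr x (r * s)"
  by (cases x) (auto simp: enn_powr_ennreal powr_powr)

lemma enn_powr_add: "enn_powr x r * enn_powr x s = enn_powr x (r + s)"
  by (cases x) (auto simp: enn_powr_ennreal powr_add simp flip: ennreal_mult)

lemma enn_powr_measurable [measurable]:
  assumes [measurable]: "f \<in> borel_measurable M"
  shows "(\<lambda>x. enn_powr (f x) r) \<in> borel_measurable M"
  unfolding enn_powr_def by measurable

text \<open>The convex function x^q lies above its tangent at m. The terms are arranged without
  subtraction so that the inequality can be moved to \<open>ennreal\<close> and integrated
  there.\<close>

lemma powr_tangent_le:
  fixes x m q :: real
  assumes "0 \<le> x" "0 \<le> m" "1 \<le> q"
  shows "q * (m powr (q - 1) * x) \<le> x powr q + (q - 1) * m powr q"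
proof (cases "x = 0 \<or> m = 0")
  case False
  have "(x powr q) powr (1/q) * (m powr q) powr (1 - 1/q) \<le> (1/q) * x powr q + (1 - 1/q) * m powr q"
    using assms False by (intro Youngs_inequality_0) auto
  moreover have "(x powr q) powr (1/q) = x" using assms by (simp add: powr_powr)
  moreover have "(m powr q) powr (1 - 1/q) = m powr (q - 1)"
    using assms by (simp add: powr_powr algebra_simps)
  ultimately have "x * m powr (q - 1) \<le> (1/q) * x powr q + (1 - 1/q) * m powr q" by simp
  then have "q * (x * m powr (q - 1)) \<le> q * ((1/q) * x powr q + (1 - 1/q) * m powr q)"
    using assms by (intro mult_left_mono) auto
  also have "\<dots> = x powr q + (q - 1) * m powr q"
    using assms by (simp add: field_simps)
  finally show ?thesis by (simp add: mult_ac)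
qed (use assms in auto)

text \<open>Jensen's inequality for a measure of arbitrary finite mass N, whence the factor N^(q-1).
  It comes from integrating the tangent inequality with m the mean value of
  \<open>g\<close>.\<close>

lemma enn_powr_nn_integral_le:
  assumes [measurable]: "g \<in> borel_measurable M" and fin: "emeasure M (space M) < \<infinity>" and q: "1 \<le> q"
  shows "enn_powr (\<integral>\<^sup>+x. g x \<partial>M) q \<le> (\<integral>\<^sup>+x. enn_powr (g x) q \<partial>M) * enn_powr (emeasure M (space M)) (q - 1)"
proof (cases "emeasure M (space M) = 0")
  case True
  have "(\<integral>\<^sup>+x. g x \<partial>M) = (\<integral>\<^sup>+x. g x * indicator (space M) x \<partial>M)"
    by (intro nn_integral_cong) simp
  also have "\<dots> = 0"
    using True by (intro nn_integral_null_set) auto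
  finally show ?thesis by simp
next
  case nz: False
  show ?thesis
  proof (cases "(\<integral>\<^sup>+x. enn_powr (g x) q \<partial>M) = \<infinity>")
    case True
    then show ?thesis using nz by (simp add: ennreal_top_mult)
  next
    case False
    obtain N where N: "emeasure M (space M) = ennreal N" "0 < N"
      using fin nz by (cases "emeasure M (space M)") (auto simp: less_le)
    obtain G where G: "(\<integral>\<^sup>+x. enn_powr (g x) q \<partial>M) = ennreal G" "0 \<le> G"
      using False by (cases "\<integral>\<^sup>+x. enn_powr (g x) q \<partial>M") auto
    have tangent: "ennreal (q * m powr (q - 1)) * y \<le> enn_powr y q + ennreal ((q - 1) * m powr q)"
      if "0 < m" for m y
    proof (cases y)
      case (real r)
      then show ?thesis using powr_tangent_le[of r m q] that q
        by (simp add: enn_powr_ennreal mult.assoc flip: ennreal_mult ennreal_plus)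
    qed auto
    have int: "ennreal (q * m powr (q - 1)) * (\<integral>\<^sup>+x. g x \<partial>M) \<le> ennreal (G + (q - 1) * m powr q * N)"
      if "0 < m" for m
    proof -
      have "ennreal (q * m powr (q - 1)) * (\<integral>\<^sup>+x. g x \<partial>M) = (\<integral>\<^sup>+x. ennreal (q * m powr (q - 1)) * g x \<partial>M)"
        by (simp add: nn_integral_cmult)
      also have "\<dots> \<le> (\<integral>\<^sup>+x. enn_powr (g x) q + ennreal ((q - 1) * m powr q) \<partial>M)"
        by (intro nn_integral_mono tangent that)
      also have "\<dots> = ennreal G + ennreal ((q - 1) * m powr q) * ennreal N"
        by (simp add: nn_integral_add G N)
      also have "\<dots> = ennreal (G + (q - 1) * m powr q * N)"
        using G N q by (simp flip: ennreal_mult ennreal_plus)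
      finally show ?thesis .
    qed
    have "(\<integral>\<^sup>+x. g x \<partial>M) \<noteq> \<infinity>"
    proof
      assume "(\<integral>\<^sup>+x. g x \<partial>M) = \<infinity>"
      \<comment> \<open>Already the tangent at m = 1 has a right side with finite integral, so the
        integral of \<open>g\<close> cannot be infinite.\<close>
      then show False using int[of 1] q by (auto simp: ennreal_mult_top top_unique)
    qed
    then obtain I where I: "(\<integral>\<^sup>+x. g x \<partial>M) = ennreal I" "0 \<le> I"
      by (cases "\<integral>\<^sup>+x. g x \<partial>M") auto
    show ?thesis
    proof (cases "I = 0")
      case False
      \<comment> \<open>At the mean value the terms q m^q N and (q - 1) m^q N combine to m^q N <=
        G.\<close>
      define m where "m = I / N"
      have m: "0 < m" "I = m * N" using False I N by (auto simp: m_def)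
      have "q * m powr (q - 1) * I \<le> G + (q - 1) * m powr q * N"
        using int[OF m(1)] I G N q m(1) by (simp flip: ennreal_mult ennreal_plus)
      moreover have "m powr (q - 1) * I = m powr q * N"
        using m by (simp add: powr_diff)
      then have "q * m powr (q - 1) * I = q * (m powr q * N)" by (simp add: mult.assoc)
      ultimately have "q * (m powr q * N) \<le> G + (q - 1) * m powr q * N" by simp
      then have "m powr q * N \<le> G"
        by (simp add: algebra_simps)
      then have "m powr q * N * N powr (q - 1) \<le> G * N powr (q - 1)"
        by (intro mult_right_mono) auto
      moreover have "m powr q * N * N powr (q - 1) = I powr q"
        using m N by (simp add: powr_mult powr_diff)
      ultimately show ?thesis
        using I G N by (simp add: enn_powr_ennreal flip: ennreal_mult)
    qed (simp add: I)
  qed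
qed

text \<open>For fixed \<open>w\<close> the measure with density \<open>\<kappa>2 (w, y)\<close> in
  \<open>y\<close> has mass X(w). Jensen and Tonelli bound the inner integral by B1 X(w)^q1: one
  factor X(w) is the mass left after the column bound, the others come from Jensen. The power q2/q1
  turns this into X(w)^q2, whichever of q1 and q2 is larger, and a second use of Jensen estimates
  X.\<close>

lemma nn_integral_tensor_kernel_le:
  fixes \<kappa>1 :: "'z \<times> 'y \<Rightarrow> ennreal" and \<kappa>2 :: "'w \<times> 'y \<Rightarrow> ennreal"
  assumes sf: "sigma_finite_measure M1" "sigma_finite_measure M2"
    and fin: "finite_measure \<mu>"
    and [measurable]: "\<kappa>1 \<in> borel_measurable (M1 \<Otimes>\<^sub>M \<mu>)" "\<kappa>2 \<in> borel_measurable (M2 \<Otimes>\<^sub>M \<mu>)"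
    and q: "1 \<le> q1" "1 \<le> q2" and B1_pos: "B1 \<noteq> 0"
    and B1: "\<And>y. y \<in> space \<mu> \<Longrightarrow> (\<integral>\<^sup>+z. enn_powr (\<kappa>1 (z, y)) q1 \<partial>M1) \<le> B1"
    and B2: "\<And>y. y \<in> space \<mu> \<Longrightarrow> (\<integral>\<^sup>+w. enn_powr (\<kappa>2 (w, y)) q2 \<partial>M2) \<le> B2"
  shows "(\<integral>\<^sup>+w. enn_powr (\<integral>\<^sup>+z. enn_powr (\<integral>\<^sup>+y. \<kappa>1 (z, y) * \<kappa>2 (w, y) \<partial>\<mu>) q1 \<partial>M1) (q2 / q1) \<partial>M2)
    \<le> enn_powr B1 (q2 / q1) * B2 * enn_powr (emeasure \<mu> (space \<mu>)) q2"
proof -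
  interpret M1: sigma_finite_measure M1 by fact
  interpret M2: sigma_finite_measure M2 by fact
  interpret \<mu>: finite_measure \<mu> by fact
  interpret P1: pair_sigma_finite M1 \<mu> ..
  interpret P2: pair_sigma_finite M2 \<mu> ..
  define X where "X w = (\<integral>\<^sup>+y. \<kappa>2 (w, y) \<partial>\<mu>)" for w
  have inner: "enn_powr (\<integral>\<^sup>+z. enn_powr (\<integral>\<^sup>+y. \<kappa>1 (z, y) * \<kappa>2 (w, y) \<partial>\<mu>) q1 \<partial>M1) (q2 / q1)
      \<le> enn_powr B1 (q2 / q1) * enn_powr (X w) q2" if w[measurable]: "w \<in> space M2" for w
  proof (cases "X w = \<infinity>")
    case True
    \<comment> \<open>A nonzero \<open>B1\<close> makes the right side infinite; otherwise the
      product would be 0 * top = 0.\<close>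
    then show ?thesis using B1_pos by (simp add: ennreal_mult_top)
  next
    case False
    have [measurable]: "(\<lambda>y. \<kappa>2 (w, y)) \<in> borel_measurable \<mu>" by measurable
    define \<nu> where "\<nu> = density \<mu> (\<lambda>y. \<kappa>2 (w, y))"
    have \<nu>: "emeasure \<nu> (space \<nu>) = X w"
      by (simp add: \<nu>_def X_def emeasure_density nn_integral_set_ennreal cong: nn_integral_cong)
    have jensen: "enn_powr (\<integral>\<^sup>+y. \<kappa>1 (z, y) * \<kappa>2 (w, y) \<partial>\<mu>) q1
        \<le> (\<integral>\<^sup>+y. \<kappa>2 (w, y) * enn_powr (\<kappa>1 (z, y)) q1 \<partial>\<mu>) * enn_powr (X w) (q1 - 1)"
      if z[measurable]: "z \<in> space M1" for z
    proof -
      have [measurable]: "(\<lambda>y. \<kappa>1 (z, y)) \<in> borel_measurable \<mu>" by measurable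
      have "(\<integral>\<^sup>+y. \<kappa>1 (z, y) * \<kappa>2 (w, y) \<partial>\<mu>) = (\<integral>\<^sup>+y. \<kappa>1 (z, y) \<partial>\<nu>)"
        by (simp add: \<nu>_def nn_integral_density mult.commute)
      then have "enn_powr (\<integral>\<^sup>+y. \<kappa>1 (z, y) * \<kappa>2 (w, y) \<partial>\<mu>) q1
          \<le> (\<integral>\<^sup>+y. enn_powr (\<kappa>1 (z, y)) q1 \<partial>\<nu>) * enn_powr (X w) (q1 - 1)"
        using enn_powr_nn_integral_le[of "\<lambda>y. \<kappa>1 (z, y)" \<nu> q1] \<nu> False q
        by (simp add: less_top \<nu>_def)
      then show ?thesis
        by (simp add: \<nu>_def nn_integral_density)
    qed
    have "(\<integral>\<^sup>+z. enn_powr (\<integral>\<^sup>+y. \<kappa>1 (z, y) * \<kappa>2 (w, y) \<partial>\<mu>) q1 \<partial>M1)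
        \<le> (\<integral>\<^sup>+z. (\<integral>\<^sup>+y. \<kappa>2 (w, y) * enn_powr (\<kappa>1 (z, y)) q1 \<partial>\<mu>) * enn_powr (X w) (q1 - 1) \<partial>M1)"
      by (intro nn_integral_mono jensen)
    also have "\<dots> = (\<integral>\<^sup>+z. (\<integral>\<^sup>+y. \<kappa>2 (w, y) * enn_powr (\<kappa>1 (z, y)) q1 \<partial>\<mu>) \<partial>M1) * enn_powr (X w) (q1 - 1)"
      by (intro nn_integral_multc) measurable
    also have "(\<integral>\<^sup>+z. (\<integral>\<^sup>+y. \<kappa>2 (w, y) * enn_powr (\<kappa>1 (z, y)) q1 \<partial>\<mu>) \<partial>M1)
        = (\<integral>\<^sup>+y. (\<integral>\<^sup>+z. \<kappa>2 (w, y) * enn_powr (\<kappa>1 (z, y)) q1 \<partial>M1) \<partial>\<mu>)"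
      by (rule P1.Fubini'[symmetric]) measurable
    also have "\<dots> = (\<integral>\<^sup>+y. \<kappa>2 (w, y) * (\<integral>\<^sup>+z. enn_powr (\<kappa>1 (z, y)) q1 \<partial>M1) \<partial>\<mu>)"
      by (intro nn_integral_cong nn_integral_cmult) measurable
    also have "\<dots> \<le> (\<integral>\<^sup>+y. \<kappa>2 (w, y) * B1 \<partial>\<mu>)"
      by (intro nn_integral_mono mult_left_mono B1) auto
    also have "\<dots> = X w * B1"
      by (simp add: nn_integral_multc X_def)
    finally have "(\<integral>\<^sup>+z. enn_powr (\<integral>\<^sup>+y. \<kappa>1 (z, y) * \<kappa>2 (w, y) \<partial>\<mu>) q1 \<partial>M1)
        \<le> B1 * (enn_powr (X w) 1 * enn_powr (X w) (q1 - 1))"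
      by (simp add: mult_ac mult_right_mono)
    then have "(\<integral>\<^sup>+z. enn_powr (\<integral>\<^sup>+y. \<kappa>1 (z, y) * \<kappa>2 (w, y) \<partial>\<mu>) q1 \<partial>M1) \<le> B1 * enn_powr (X w) q1"
      unfolding enn_powr_add by simp
    then have "enn_powr (\<integral>\<^sup>+z. enn_powr (\<integral>\<^sup>+y. \<kappa>1 (z, y) * \<kappa>2 (w, y) \<partial>\<mu>) q1 \<partial>M1) (q2 / q1)
        \<le> enn_powr (B1 * enn_powr (X w) q1) (q2 / q1)"
      using q by (intro enn_powr_mono) auto
    then show ?thesis using q by (simp add: enn_powr_mult enn_powr_powr)
  qed
  let ?N = "emeasure \<mu> (space \<mu>)"
  have [measurable]: "X \<in> borel_measurable M2" unfolding X_def by measurable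
  have "(\<integral>\<^sup>+w. enn_powr (\<integral>\<^sup>+z. enn_powr (\<integral>\<^sup>+y. \<kappa>1 (z, y) * \<kappa>2 (w, y) \<partial>\<mu>) q1 \<partial>M1) (q2 / q1) \<partial>M2)
      \<le> (\<integral>\<^sup>+w. enn_powr B1 (q2 / q1) * enn_powr (X w) q2 \<partial>M2)"
    by (intro nn_integral_mono inner)
  also have "\<dots> = enn_powr B1 (q2 / q1) * (\<integral>\<^sup>+w. enn_powr (X w) q2 \<partial>M2)"
    by (simp add: nn_integral_cmult)
  also have "(\<integral>\<^sup>+w. enn_powr (X w) q2 \<partial>M2)
      \<le> (\<integral>\<^sup>+w. (\<integral>\<^sup>+y. enn_powr (\<kappa>2 (w, y)) q2 \<partial>\<mu>) * enn_powr ?N (q2 - 1) \<partial>M2)"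
    unfolding X_def using q \<mu>.emeasure_finite
    by (intro nn_integral_mono enn_powr_nn_integral_le) (auto simp: less_top[symmetric])
  also have "\<dots> = (\<integral>\<^sup>+w. (\<integral>\<^sup>+y. enn_powr (\<kappa>2 (w, y)) q2 \<partial>\<mu>) \<partial>M2) * enn_powr ?N (q2 - 1)"
    by (intro nn_integral_multc) measurable
  also have "(\<integral>\<^sup>+w. (\<integral>\<^sup>+y. enn_powr (\<kappa>2 (w, y)) q2 \<partial>\<mu>) \<partial>M2)
      = (\<integral>\<^sup>+y. (\<integral>\<^sup>+w. enn_powr (\<kappa>2 (w, y)) q2 \<partial>M2) \<partial>\<mu>)"
    by (rule P2.Fubini'[symmetric]) measurable
  also have "\<dots> \<le> (\<integral>\<^sup>+y. B2 \<partial>\<mu>)"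
    by (intro nn_integral_mono B2)
  also have "\<dots> = B2 * enn_powr ?N 1" by simp
  finally have "(\<integral>\<^sup>+w. enn_powr (\<integral>\<^sup>+z. enn_powr (\<integral>\<^sup>+y. \<kappa>1 (z, y) * \<kappa>2 (w, y) \<partial>\<mu>) q1 \<partial>M1) (q2 / q1) \<partial>M2)
      \<le> enn_powr B1 (q2 / q1) * (B2 * (enn_powr ?N 1 * enn_powr ?N (q2 - 1)))"
    by (simp add: mult_ac mult_left_mono mult_right_mono)
  then show ?thesis unfolding enn_powr_add by (simp add: mult_ac)
qed

subsection \<open>Shears and dilations of Lebesgue measure\<close>

lemma continuous_on_axis [continuous_intros]:
  fixes f :: "'a::topological_space \<Rightarrow> 'b::real_normed_vector"
  shows "continuous_on S f \<Longrightarrow> continuous_on S (\<lambda>x. axis e (f x) :: 'b^'n)"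
proof -
  assume f: "continuous_on S f"
  have "continuous_on S (\<lambda>x. if i = e then f x else 0)" for i
    using f by (cases "i = e") auto
  then show ?thesis unfolding axis_def by (intro continuous_on_vec_lambda)
qed

lemma borel_measurable_axis [measurable]: "(\<lambda>x. axis e x :: complex^'n) \<in> borel_measurable borel"
  by (intro borel_measurable_continuous_onI continuous_intros)

lemma borel_measurable_vec_nth' [measurable]: "(\<lambda>x. x $ i) \<in> borel_measurable (borel :: (complex^'n) measure)"
  by (intro borel_measurable_continuous_onI continuous_intros)

lemma nn_integral_lborel_translate:
  fixes t :: "'a::euclidean_space"
  assumes [measurable]: "F \<in> borel_measurable borel"
  shows "(\<integral>\<^sup>+z. F (t + z) \<partial>lborel) = (\<integral>\<^sup>+z. F z \<partial>lborel)"
proof -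
  have "(\<integral>\<^sup>+z. F z \<partial>lborel) = (\<integral>\<^sup>+z. F z \<partial>distr lborel borel ((+) t))"
    by (simp add: lborel_distr_plus)
  then show ?thesis by (simp add: nn_integral_distr)
qed

text \<open>Averaging against a unit box in an auxiliary variable \<open>t\<close> turns the shear into a translation
  of \<open>t\<close>, so no coordinate decomposition of Lebesgue measure is needed.\<close>

lemma nn_integral_lborel_shear:
  fixes F :: "complex^'n \<Rightarrow> ennreal" and g :: "complex^'n \<Rightarrow> complex"
  assumes [measurable]: "F \<in> borel_measurable borel" "g \<in> borel_measurable borel"
    and inv: "\<And>z t. g (z + axis e t) = g z"
  shows "(\<integral>\<^sup>+z. F (z + axis e (g z)) \<partial>lborel) = (\<integral>\<^sup>+z. F z \<partial>lborel)"
proof -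
  define \<phi> :: "complex \<Rightarrow> ennreal" where "\<phi> = indicator (cbox 0 (Complex 1 1))"
  have [measurable]: "\<phi> \<in> borel_measurable borel" by (simp add: \<phi>_def)
  have "(\<integral>\<^sup>+t. \<phi> t \<partial>lborel) = 1"
    by (simp add: \<phi>_def emeasure_lborel_cbox_eq Basis_complex_def)
  then have \<phi>1: "(\<integral>\<^sup>+t. \<phi> (t - c) \<partial>lborel) = 1" for c
    using nn_integral_lborel_translate[of \<phi> "-c"] by simp
  \<comment> \<open>The right side does not mention \<open>h\<close>, so the shears by
    \<open>g\<close> and by 0 have the same integral. Translating z by t in coordinate e frees the
    box factor from t, and then \<open>h z\<close> merely shifts t.\<close>
  have key: "(\<integral>\<^sup>+z. F (z + axis e (h z)) \<partial>lborel)
      = (\<integral>\<^sup>+z. \<phi> (- (z $ e)) * (\<integral>\<^sup>+t. F (z + axis e t) \<partial>lborel) \<partial>lborel)"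
    if [measurable]: "h \<in> borel_measurable borel" and inv: "\<And>z t. h (z + axis e t) = h z" for h
  proof -
    have "(\<integral>\<^sup>+z. F (z + axis e (h z)) \<partial>lborel)
        = (\<integral>\<^sup>+z. (\<integral>\<^sup>+t. \<phi> (t - z $ e) * F (z + axis e (h z)) \<partial>lborel) \<partial>lborel)"
      by (simp add: nn_integral_multc \<phi>1)
    also have "\<dots> = (\<integral>\<^sup>+t. (\<integral>\<^sup>+z. \<phi> (t - z $ e) * F (z + axis e (h z)) \<partial>lborel) \<partial>lborel)"
      by (rule lborel_pair.Fubini'[symmetric]) measurable
    also have "\<dots> = (\<integral>\<^sup>+t. (\<integral>\<^sup>+z. \<phi> (- (z $ e)) * F (z + axis e (t + h z)) \<partial>lborel) \<partial>lborel)"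
    proof (rule nn_integral_cong)
      fix t :: complex
      have ax: "axis e (t + r) = axis e t + (axis e r :: complex^'n)" for r
        by (simp add: vec_eq_iff axis_def)
      show "(\<integral>\<^sup>+z. \<phi> (t - z $ e) * F (z + axis e (h z)) \<partial>lborel)
          = (\<integral>\<^sup>+z. \<phi> (- (z $ e)) * F (z + axis e (t + h z)) \<partial>lborel)"
        using inv
        by (subst nn_integral_lborel_translate[symmetric, where t = "axis e t"])
           (auto simp: ax add_ac intro!: nn_integral_cong)
    qed
    also have "\<dots> = (\<integral>\<^sup>+z. (\<integral>\<^sup>+t. \<phi> (- (z $ e)) * F (z + axis e (t + h z)) \<partial>lborel) \<partial>lborel)"
      by (rule lborel_pair.Fubini') measurable
    also have "\<dots> = (\<integral>\<^sup>+z. \<phi> (- (z $ e)) * (\<integral>\<^sup>+t. F (z + axis e t) \<partial>lborel) \<partial>lborel)"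
    proof (rule nn_integral_cong)
      fix z :: "complex^'n"
      have "(\<integral>\<^sup>+t. F (z + axis e (t + h z)) \<partial>lborel) = (\<integral>\<^sup>+t. F (z + axis e t) \<partial>lborel)"
        using nn_integral_lborel_translate[of "\<lambda>t. F (z + axis e t)" "h z"] by (simp add: add.commute)
      then show "(\<integral>\<^sup>+t. \<phi> (- (z $ e)) * F (z + axis e (t + h z)) \<partial>lborel)
          = \<phi> (- (z $ e)) * (\<integral>\<^sup>+t. F (z + axis e t) \<partial>lborel)"
        by (simp add: nn_integral_cmult)
    qed
    finally show ?thesis .
  qed
  have ax0: "axis e 0 = (0 :: complex^'n)" by (simp add: vec_eq_iff axis_def)
  show ?thesis using key[of g] key[of "\<lambda>_. 0"] inv by (simp add: ax0)
qed

lemma prod_Basis_complex_vec: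
  "(\<Prod>b\<in>(Basis :: (complex^'n) set). f b) = (\<Prod>i\<in>UNIV. f (axis i 1) * f (axis i \<i>))"
proof -
  have B: "(Basis :: (complex^'n) set) = (\<lambda>(i, u). axis i u) ` (UNIV \<times> {1, \<i>})"
    by (auto simp: Basis_vec_def Basis_complex_def)
  have "inj_on (\<lambda>(i, u). axis i u :: complex^'n) (UNIV \<times> {1, \<i>})"
    by (auto simp: inj_on_def axis_eq_axis)
  then have "(\<Prod>b\<in>(Basis :: (complex^'n) set). f b) = (\<Prod>(i, u)\<in>UNIV \<times> {1, \<i>}. f (axis i u))"
    unfolding B by (subst prod.reindex) (auto simp: case_prod_beta)
  also have "\<dots> = (\<Prod>i\<in>UNIV. \<Prod>u\<in>{1, \<i>}. f (axis i u))"
    by (rule prod.cartesian_product[symmetric])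
  finally show ?thesis by (simp add: complex_i_not_one[symmetric])
qed

lemma nn_integral_lborel_prod_complex_vec:
  fixes f g :: "'n::finite \<Rightarrow> real \<Rightarrow> ennreal"
  assumes [measurable]: "\<And>i. f i \<in> borel_measurable borel" "\<And>i. g i \<in> borel_measurable borel"
  shows "(\<integral>\<^sup>+z. (\<Prod>i\<in>UNIV. f i (Re (z $ i)) * g i (Im (z $ i))) \<partial>lborel)
    = (\<Prod>i\<in>UNIV. (\<integral>\<^sup>+x. f i x \<partial>lborel) * (\<integral>\<^sup>+x. g i x \<partial>lborel))"
proof -
  \<comment> \<open>The product formula for Lebesgue measure wants factors indexed by basis vectors.
    \<open>h\<close> recovers the coordinate from the only nonzero entry of \<open>b\<close>, and
    the real or imaginary direction from whether that entry is 1.\<close>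
  define h where "h b = (let i = (SOME i. b $ i \<noteq> (0::complex)) in if b $ i = 1 then f i else g i)" for b :: "complex^'n"
  have some: "(SOME j. axis i u $ j \<noteq> (0::complex)) = i" if "u \<noteq> 0" for i :: 'n and u
    using that by (intro some_equality) (auto simp: axis_def split: if_splits)
  have h: "h (axis i 1) = f i" "h (axis i \<i>) = g i" for i
    by (simp_all add: h_def some Let_def)
  have [measurable]: "h b \<in> borel_measurable borel" for b by (simp add: h_def Let_def)
  have "(\<integral>\<^sup>+z. (\<Prod>b\<in>Basis. h b (z \<bullet> b)) \<partial>lborel) = (\<Prod>b\<in>Basis. (\<integral>\<^sup>+x. h b x \<partial>lborel))"
    by (intro nn_integral_lborel_prod) auto
  then show ?thesis
    by (simp add: prod_Basis_complex_vec h inner_axis)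
qed

text \<open>The square root on z' matches the fact that \<rho> is quadratic in z' and linear in z_n,
  so that \<rho> is homogeneous of degree 1. The Jacobian is R^2 for z_n times R for each of the n -
  1 other complex coordinates, which gives R^(n+1).\<close>

definition dil :: "'n::finite \<Rightarrow> real \<Rightarrow> complex^'n \<Rightarrow> complex^'n" where
  "dil e R z = (\<chi> i. if i = e then R *\<^sub>R (z $ i) else sqrt R *\<^sub>R (z $ i))"

lemma nn_integral_lborel_dil:
  fixes F :: "complex^'n \<Rightarrow> ennreal"
  assumes [measurable]: "F \<in> borel_measurable borel" and R: "R > 0"
  shows "(\<integral>\<^sup>+z. F z \<partial>lborel) = ennreal (R ^ (CARD('n) + 1)) * (\<integral>\<^sup>+z. F (dil e R z) \<partial>lborel)"
proof -
  define c where "c b = (if b $ e = 0 then sqrt R else R)" for b :: "complex^'n"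
  have c: "c (axis i u) = (if i = e then R else sqrt R)" if "u \<noteq> 0" for i u
    using that by (auto simp: c_def axis_def)
  let ?T = "\<lambda>x::complex^'n. 0 + (\<Sum>j\<in>Basis. (c j * (x \<bullet> j)) *\<^sub>R j)"
  have comp: "(dil e R x) \<bullet> b = c b * (x \<bullet> b)" if "b \<in> Basis" for x b
    using that by (auto simp: Basis_vec_def Basis_complex_def inner_axis c dil_def)
  have T: "?T x = dil e R x" for x
    by (subst euclidean_representation[symmetric, of "dil e R x"]) (simp add: comp)
  have [measurable]: "dil e R \<in> borel_measurable borel"
  proof (intro borel_measurable_continuous_onI)
    have "continuous_on UNIV (\<lambda>z :: complex^'n. if i = e then R *\<^sub>R (z $ i) else sqrt R *\<^sub>R (z $ i))" for i
      by (cases "i = e") (auto intro!: continuous_intros)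
    then show "continuous_on UNIV (dil e R)"
      unfolding dil_def[abs_def] by (intro continuous_on_vec_lambda)
  qed
  have "(\<Prod>j\<in>Basis. \<bar>c j\<bar>) = (\<Prod>i\<in>UNIV. if i = e then R * R else R)"
    unfolding prod_Basis_complex_vec using R by (intro prod.cong) (auto simp: c)
  also have "\<dots> = R * R * (\<Prod>i\<in>UNIV - {e}. R)"
    by (subst prod.remove[of _ e]) (auto intro!: prod.cong)
  also have "\<dots> = R ^ (CARD('n) + 1)"
    using card_gt_0_iff[of "UNIV :: 'n set"]
    by (simp add: card_Diff_singleton mult.assoc flip: power_Suc)
  finally have P: "(\<Prod>j\<in>Basis. \<bar>c j\<bar>) = R ^ (CARD('n) + 1)" .
  have "lborel = density (distr lborel borel ?T) (\<lambda>_. (\<Prod>j\<in>Basis. \<bar>c j\<bar>))"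
    using R by (intro lborel_affine_euclidean) (auto simp: c_def)
  then have L: "lborel = density (distr lborel borel (dil e R)) (\<lambda>_. ennreal (R ^ (CARD('n) + 1)))"
    unfolding T P .
  show ?thesis
    by (subst L) (simp add: nn_integral_density nn_integral_distr nn_integral_cmult)
qed

subsection \<open>Forelli-Rudin integrals\<close>

text \<open>By the parallelogram identity, Re((z_i - cnj u_i)^2) = |z_i - u_i|^2 - 2 (Im z_i)^2 - 2
  (Im u_i)^2, and the last two terms complete the imaginary parts of the last coordinates to 2
  \<rho>(z) + 2 \<rho>(u). Positivity is visible in this form.\<close>

lemma Re_rho2: "Re (rho2 e z u) = (2 * rho e z + 2 * rho e u + (\<Sum>i\<in>UNIV - {e}. (cmod (z $ i - u $ i))\<^sup>2)) / 4"
proof -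
  have "(\<Sum>i\<in>UNIV - {e}. Re ((z $ i - cnj (u $ i))\<^sup>2))
      = (\<Sum>i\<in>UNIV - {e}. (cmod (z $ i - u $ i))\<^sup>2 - 2 * (Im (z $ i))\<^sup>2 - 2 * (Im (u $ i))\<^sup>2)"
    unfolding cmod_power2 by (intro sum.cong) (auto simp: power2_eq_square algebra_simps)
  then show ?thesis
    by (simp add: rho2_def rho_def sum_subtractf sum_distrib_left)
qed

lemma Im_rho2: "Im (rho2 e z u) = ((\<Sum>i\<in>UNIV - {e}. (Re (z $ i) - Re (u $ i)) * (Im (z $ i) + Im (u $ i))) - (Re (z $ e) - Re (u $ e))) / 2"
proof -
  have "(\<Sum>i\<in>UNIV - {e}. Im ((z $ i - cnj (u $ i))\<^sup>2))
      = (\<Sum>i\<in>UNIV - {e}. 2 * ((Re (z $ i) - Re (u $ i)) * (Im (z $ i) + Im (u $ i))))"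
    by (intro sum.cong) (auto simp: power2_eq_square algebra_simps)
  then show ?thesis
    by (simp add: rho2_def flip: sum_distrib_left)
qed

lemma Re_rho2_pos: "z \<in> TB e \<Longrightarrow> u \<in> TB e \<Longrightarrow> 0 < Re (rho2 e z u)"
  unfolding Re_rho2 TB_def by (auto intro!: add_pos_nonneg sum_nonneg)

lemma rho2_nz: "z \<in> TB e \<Longrightarrow> u \<in> TB e \<Longrightarrow> rho2 e z u \<noteq> 0"
  using Re_rho2_pos[of z e u] by auto

lemma continuous_on_rho [continuous_intros]:
  "continuous_on S f \<Longrightarrow> continuous_on S (\<lambda>x. rho e (f x))"
  unfolding rho_def by (intro continuous_intros)

lemma continuous_on_rho2 [continuous_intros]:
  "continuous_on S f \<Longrightarrow> continuous_on S g \<Longrightarrow> continuous_on S (\<lambda>x. rho2 e (f x) (g x))"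
  unfolding rho2_def by (intro continuous_intros)

lemma open_TB: "open (TB e)"
  unfolding TB_def by (intro open_Collect_less continuous_intros)

lemma borel_TB [measurable]: "TB e \<in> sets borel"
  by (simp add: borel_open open_TB)

lemma borel_measurable_rho [measurable]: "rho e \<in> borel_measurable borel"
  by (intro borel_measurable_continuous_onI continuous_intros)

lemma borel_measurable_rho2 [measurable (raw)]:
  assumes [measurable]: "f \<in> borel_measurable M" "g \<in> borel_measurable M"
  shows "(\<lambda>x. rho2 e (f x) (g x)) \<in> borel_measurable M"
  using assms by (rule borel_measurable_continuous_Pair) (intro continuous_intros)

text \<open>In the coordinates \<open>z' - u'\<close> and \<open>z\<^sub>n\<close> sheared so that \<open>\<rho>(z)\<close> becomes \<open>Im z\<^sub>n\<close>, the complex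
  conjugate of \<open>\<rho>(z,u)\<close> depends on \<open>u\<close> only through \<open>R = \<rho>(u)\<close>.\<close>

definition flat_rho2 :: "'n::finite \<Rightarrow> real \<Rightarrow> complex^'n \<Rightarrow> complex" where
  "flat_rho2 e R z = Complex (2 * Im (z $ e) + 2 * R + (\<Sum>i\<in>UNIV - {e}. (cmod (z $ i))\<^sup>2)) (2 * Re (z $ e)) / 4"

definition flat_integrand :: "'n::finite \<Rightarrow> real \<Rightarrow> real \<Rightarrow> real \<Rightarrow> complex^'n \<Rightarrow> ennreal" where
  "flat_integrand e s t R z = ennreal (Im (z $ e) powr s / cmod (flat_rho2 e R z) powr t) * indicator {0<..} (Im (z $ e))"

text \<open>The constant of the Forelli-Rudin estimate, taken at height R = 1. Its value may be
  infinite, and the necessity direction reads the conditions on s and t off its finiteness.\<close>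

definition FR_const :: "'n::finite \<Rightarrow> real \<Rightarrow> real \<Rightarrow> ennreal" where
  "FR_const e s t = (\<integral>\<^sup>+z. flat_integrand e s t 1 z \<partial>lborel)"

lemma borel_measurable_flat_rho2 [measurable]: "flat_rho2 e R \<in> borel_measurable borel"
  unfolding flat_rho2_def[abs_def] Complex_eq by measurable

lemma borel_measurable_flat_integrand [measurable]: "flat_integrand e s t R \<in> borel_measurable borel"
  unfolding flat_integrand_def[abs_def] by measurable

text \<open>The dilation multiplies the flattened kernel by R, so the exponent collects n + 1 from
  the Jacobian, s from the numerator and -t from the denominator. The identity also holds between
  infinite values.\<close>

lemma nn_integral_flat_integrand:
  fixes e :: "'n::finite"
  assumes R: "R > 0"
  shows "(\<integral>\<^sup>+z. flat_integrand e s t R z \<partial>lborel) = ennreal (R powr (real CARD('n) + 1 + s - t)) * FR_const e s t"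
proof -
  have [simp]: "flat_rho2 e R (dil e R z) = of_real R * flat_rho2 e 1 z" for z
    using R by (simp add: flat_rho2_def dil_def complex_eq_iff power_mult_distrib algebra_simps sum_distrib_left)
  have [simp]: "dil e R z $ e = of_real R * z $ e" for z
    by (simp add: dil_def scaleR_conv_of_real)
  have "flat_integrand e s t R (dil e R z) = ennreal (R powr (s - t)) * flat_integrand e s t 1 z" for z
    using R by (cases "Im (z $ e) > 0") (auto simp: flat_integrand_def norm_mult powr_mult powr_diff zero_less_mult_iff simp flip: ennreal_mult)
  then have "(\<integral>\<^sup>+z. flat_integrand e s t R z \<partial>lborel)
      = ennreal (R ^ (CARD('n) + 1)) * (ennreal (R powr (s - t)) * FR_const e s t)"
    using R by (subst nn_integral_lborel_dil[where R = R and e = e]) (auto simp: nn_integral_cmult FR_const_def)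
  also have "\<dots> = ennreal (R powr (real (CARD('n) + 1)) * R powr (s - t)) * FR_const e s t"
    using R by (simp add: powr_realpow ennreal_mult mult.assoc del: of_nat_add of_nat_Suc)
  also have "R powr (real (CARD('n) + 1)) * R powr (s - t) = R powr (real CARD('n) + 1 + s - t)"
    by (simp add: algebra_simps flip: powr_add)
  finally show ?thesis .
qed

lemma nn_integral_rho_rho2:
  fixes e :: "'n::finite"
  assumes u: "u \<in> TB e"
  shows "(\<integral>\<^sup>+z. ennreal (rho e z powr s / cmod (rho2 e z u) powr t) * indicator (TB e) z \<partial>lborel)
    = ennreal (rho e u powr (real CARD('n) + 1 + s - t)) * FR_const e s t"
proof -
  \<comment> \<open>\<open>v\<close> centres the first coordinates at u'. The imaginary part of
    \<open>g\<close> restores |y'|^2, so that \<rho> becomes Im z_n; its real part cancels the cross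
    terms of \<open>Im_rho2\<close> and leaves -Re z_n / 2. Neither part involves coordinate e, as a
    shear requires.\<close>
  define v where "v = (\<chi> i. if i = e then 0 else u $ i)"
  define g where "g z = Complex (Re (u $ e) + (\<Sum>i\<in>UNIV - {e}. Re (z $ i) * (Im (z $ i) + 2 * Im (u $ i))))
      (\<Sum>i\<in>UNIV - {e}. (Im (z $ i) + Im (u $ i))\<^sup>2)" for z :: "complex^'n"
  have [measurable]: "g \<in> borel_measurable borel"
    unfolding g_def[abs_def] Complex_eq by measurable
  have inv: "g (z + axis e t) = g z" for z t
    unfolding g_def by (intro arg_cong2[where f = Complex] sum.cong arg_cong2[where f = "(+)"] refl) (auto simp: axis_def)
  define \<tau> where "\<tau> z = v + (z + axis e (g z))" for z
  have \<tau>_e: "\<tau> z $ e = z $ e + g z" for z by (simp add: \<tau>_def v_def axis_def)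
  have \<tau>_ne: "\<tau> z $ i = z $ i + u $ i" if "i \<noteq> e" for z i using that by (simp add: \<tau>_def v_def axis_def)
  have rho: "rho e (\<tau> z) = Im (z $ e)" for z
    by (simp add: rho_def \<tau>_e \<tau>_ne g_def)
  have "rho2 e (\<tau> z) u = cnj (flat_rho2 e (rho e u) z)" for z
    by (simp add: complex_eq_iff Re_rho2 Im_rho2 flat_rho2_def rho \<tau>_e \<tau>_ne g_def algebra_simps)
  then have rho2: "cmod (rho2 e (\<tau> z) u) = cmod (flat_rho2 e (rho e u) z)" for z by simp
  define F where "F z = ennreal (rho e z powr s / cmod (rho2 e z u) powr t) * indicator (TB e) z" for z
  have [measurable]: "F \<in> borel_measurable borel" unfolding F_def[abs_def] by measurable
  have "(\<integral>\<^sup>+z. F z \<partial>lborel) = (\<integral>\<^sup>+z. F (\<tau> z) \<partial>lborel)"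
    unfolding \<tau>_def
    by (subst nn_integral_lborel_shear[where e = e and F = "\<lambda>z. F (v + z)", OF _ _ inv])
       (auto simp: nn_integral_lborel_translate)
  also have "\<dots> = (\<integral>\<^sup>+z. flat_integrand e s t (rho e u) z \<partial>lborel)"
    by (intro nn_integral_cong) (simp add: F_def flat_integrand_def rho rho2 TB_def indicator_def)
  finally show ?thesis
    using u by (simp add: F_def nn_integral_flat_integrand TB_def)
qed

section \<open>Integrals of powers in one real variable\<close>

lemma nn_integral_powr_atLeast_1:
  assumes "p < -1"
  shows "(\<integral>\<^sup>+x. ennreal (x powr p) * indicator {1..} x \<partial>lborel) < \<infinity>"
  using nn_integral_has_integral_lebesgue'[OF _ has_integral_powr_to_inf[of p 1]] assms by simp

lemma nn_integral_powr_0_1: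
  assumes "p > -1"
  shows "(\<integral>\<^sup>+x. ennreal (x powr p) * indicator {0..1} x \<partial>lborel) < \<infinity>"
  using nn_integral_has_integral_lebesgue'[OF _ has_integral_powr_from_0[of p 1]] assms by simp

text \<open>On (0,1] the function 1/x is a minorant, and its integral over [exp(-r), 1] is exactly
  r, so the integral exceeds every r.\<close>

lemma nn_integral_powr_0_1_top:
  assumes "p \<le> -1"
  shows "(\<integral>\<^sup>+x. ennreal (x powr p) * indicator {0<..1} x \<partial>lborel) = \<infinity>"
proof -
  let ?I = "\<integral>\<^sup>+x. ennreal (x powr p) * indicator {0<..1} x \<partial>lborel"
  have le: "ennreal r \<le> ?I" if "0 \<le> r" for r
  proof -
    have "ennreal r = ennreal (ln 1 - ln (exp (-r)))" by simp
    also have "\<dots> = (\<integral>\<^sup>+x. ennreal (inverse x) * indicator {exp (-r)..1} x \<partial>lborel)"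
    proof (rule nn_integral_FTC_Icc[symmetric])
      fix x assume "x \<in> {exp (-r)..1}"
      then have "exp (-r) \<le> x" by simp
      then have "0 < x" using exp_gt_zero[of "-r"] by linarith
      then show "DERIV ln x :> inverse x" "0 \<le> inverse x" by (auto intro: DERIV_ln)
    qed (use that in auto)
    also have "\<dots> \<le> ?I"
    proof (intro nn_integral_mono)
      fix x :: real
      have "inverse x \<le> x powr p" if "0 < x" "x \<le> 1"
        using that assms powr_mono'[of p "-1" x] by (simp add: powr_minus)
      then show "ennreal (inverse x) * indicator {exp (-r)..1} x \<le> ennreal (x powr p) * indicator {0<..1} x"
        using less_le_trans[OF exp_gt_zero[of "-r"], of x] by (auto simp: indicator_def intro!: ennreal_leI)
    qed
    finally show ?thesis .
  qed
  show ?thesis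
  proof (cases ?I)
    case (real x)
    then show ?thesis using le[of "x + 1"] by simp
  qed simp
qed

lemma nn_integral_one_plus_abs_powr:
  assumes "p < -1"
  shows "(\<integral>\<^sup>+x. ennreal ((1 + \<bar>x\<bar>) powr p) \<partial>lborel) < \<infinity>"
proof -
  let ?T = "\<integral>\<^sup>+x. ennreal (x powr p) * indicator {1..} x \<partial>lborel"
  have "(\<integral>\<^sup>+x. ennreal ((1 + \<bar>x\<bar>) powr p) \<partial>lborel)
      \<le> (\<integral>\<^sup>+x. ennreal ((1 + x) powr p) * indicator {1..} (1 + x)
            + ennreal ((1 - x) powr p) * indicator {1..} (1 - x) \<partial>lborel)"
    by (intro nn_integral_mono) (auto simp: indicator_def)
  also have "\<dots> = (\<integral>\<^sup>+x. ennreal ((1 + x) powr p) * indicator {1..} (1 + x) \<partial>lborel)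
            + (\<integral>\<^sup>+x. ennreal ((1 - x) powr p) * indicator {1..} (1 - x) \<partial>lborel)"
    by (intro nn_integral_add) measurable
  also have "(\<integral>\<^sup>+x. ennreal ((1 + x) powr p) * indicator {1..} (1 + x) \<partial>lborel) = ?T"
    using nn_integral_real_affine[of "\<lambda>x. ennreal (x powr p) * indicator {1..} x" 1 1] by simp
  also have "(\<integral>\<^sup>+x. ennreal ((1 - x) powr p) * indicator {1..} (1 - x) \<partial>lborel) = ?T"
    using nn_integral_real_affine[of "\<lambda>x. ennreal (x powr p) * indicator {1..} x" "-1" 1] by simp
  finally show ?thesis
    using nn_integral_powr_atLeast_1[OF assms] by (auto simp: less_top[symmetric] top_unique)
qed

text \<open>Since (1 + |x|)^2 <= 2 (1 + x^2), the integrand is dominated by a multiple of (1 +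
  |x|)^(2p), and 2p < -1.\<close>

lemma nn_integral_one_plus_square_powr:
  assumes "p < - 1 / 2"
  shows "(\<integral>\<^sup>+x. ennreal ((1 + x\<^sup>2) powr p) \<partial>lborel) < \<infinity>"
proof -
  have "(\<integral>\<^sup>+x. ennreal ((1 + x\<^sup>2) powr p) \<partial>lborel)
      \<le> (\<integral>\<^sup>+x. ennreal (2 powr - p) * ennreal ((1 + \<bar>x\<bar>) powr (2 * p)) \<partial>lborel)"
  proof (intro nn_integral_mono)
    fix x :: real
    have "(1 + \<bar>x\<bar>)\<^sup>2 / 2 \<le> 1 + x\<^sup>2"
      using sum_squares_ge_zero[of "\<bar>x\<bar> - 1" 0] by (simp add: power2_eq_square algebra_simps)
    then have "(1 + x\<^sup>2) powr p \<le> ((1 + \<bar>x\<bar>)\<^sup>2 / 2) powr p"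
      using assms by (intro powr_mono2') auto
    also have "\<dots> = 2 powr - p * ((1 + \<bar>x\<bar>) powr 2) powr p"
      by (simp add: powr_divide powr_minus field_simps)
    also have "\<dots> = 2 powr - p * (1 + \<bar>x\<bar>) powr (2 * p)"
      by (simp only: powr_powr)
    finally show "ennreal ((1 + x\<^sup>2) powr p) \<le> ennreal (2 powr - p) * ennreal ((1 + \<bar>x\<bar>) powr (2 * p))"
      by (simp flip: ennreal_mult)
  qed
  also have "\<dots> = ennreal (2 powr - p) * (\<integral>\<^sup>+x. ennreal ((1 + \<bar>x\<bar>) powr (2 * p)) \<partial>lborel)"
    by (intro nn_integral_cmult) measurable
  also have "\<dots> < \<infinity>"
    using nn_integral_one_plus_abs_powr[of "2 * p"] assms
    by (auto simp: ennreal_mult_less_top)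
  finally show ?thesis .
qed

text \<open>The integrand behaves like y^s at 0 and like y^(-1-\<epsilon>) at infinity; these are
  the majorants on either side of y = 1.\<close>

lemma nn_integral_powr_one_plus_powr:
  assumes "s > -1" "\<epsilon> > 0"
  shows "(\<integral>\<^sup>+y. ennreal (y powr s * (1 + y) powr - (s + 1 + \<epsilon>)) * indicator {0<..} y \<partial>lborel) < \<infinity>"
proof -
  have "(\<integral>\<^sup>+y. ennreal (y powr s * (1 + y) powr - (s + 1 + \<epsilon>)) * indicator {0<..} y \<partial>lborel)
      \<le> (\<integral>\<^sup>+y. ennreal (y powr s) * indicator {0..1} y + ennreal (y powr (- 1 - \<epsilon>)) * indicator {1..} y \<partial>lborel)"
  proof (intro nn_integral_mono)
    fix y :: real
    have *: "y powr s * (1 + y) powr - (s + 1 + \<epsilon>) \<le> y powr s" if "0 < y" "y \<le> 1"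
    proof -
      have "(1 + y) powr - (s + 1 + \<epsilon>) \<le> (1 + y) powr 0"
        using assms that by (intro powr_mono) auto
      then show ?thesis using that by (simp add: mult_left_le)
    qed
    have **: "y powr s * (1 + y) powr - (s + 1 + \<epsilon>) \<le> y powr (- 1 - \<epsilon>)" if "1 < y"
    proof -
      have "(1 + y) powr - (s + 1 + \<epsilon>) \<le> y powr - (s + 1 + \<epsilon>)"
        using assms that by (intro powr_mono2') auto
      then have "y powr s * (1 + y) powr - (s + 1 + \<epsilon>) \<le> y powr s * y powr - (s + 1 + \<epsilon>)"
        by (intro mult_left_mono) auto
      also have "\<dots> = y powr (- 1 - \<epsilon>)" by (simp add: algebra_simps flip: powr_add)
      finally show ?thesis .
    qed
    show "ennreal (y powr s * (1 + y) powr - (s + 1 + \<epsilon>)) * indicator {0<..} y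
        \<le> ennreal (y powr s) * indicator {0..1} y + ennreal (y powr (- 1 - \<epsilon>)) * indicator {1..} y"
      (is "_ \<le> ?A + ?B")
    proof -
      consider "y \<le> 0" | "0 < y" "y \<le> 1" | "1 < y" by linarith
      then have "ennreal (y powr s * (1 + y) powr - (s + 1 + \<epsilon>)) * indicator {0<..} y \<le> ?A
          \<or> ennreal (y powr s * (1 + y) powr - (s + 1 + \<epsilon>)) * indicator {0<..} y \<le> ?B"
        using * ** by cases (auto simp: indicator_def intro: ennreal_leI)
      then show ?thesis by (auto intro: add_increasing add_increasing2)
    qed
  qed
  also have "\<dots> = (\<integral>\<^sup>+y. ennreal (y powr s) * indicator {0..1} y \<partial>lborel)
      + (\<integral>\<^sup>+y. ennreal (y powr (- 1 - \<epsilon>)) * indicator {1..} y \<partial>lborel)"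
    by (intro nn_integral_add) measurable
  also have "\<dots> < \<infinity>"
    using nn_integral_powr_atLeast_1[of "- 1 - \<epsilon>"] nn_integral_powr_0_1[of s] assms by simp
  finally show ?thesis .
qed

section \<open>Finiteness of the Forelli-Rudin constant\<close>

context
  fixes e :: "'n::finite" and z :: "complex^'n"
  assumes z: "0 < Im (z $ e)"
begin

text \<open>One quantity dominates a function of each real coordinate separately. A power of it can
  therefore be split into shares, each charged to one coordinate, which yields a product
  majorant.\<close>

lemma cmod_flat_rho2_ge:
  "1 + Im (z $ e) \<le> 4 * cmod (flat_rho2 e 1 z)"
  "1 + \<bar>Re (z $ e)\<bar> \<le> 4 * cmod (flat_rho2 e 1 z)"
  "i \<noteq> e \<Longrightarrow> 1 + (Re (z $ i))\<^sup>2 \<le> 4 * cmod (flat_rho2 e 1 z)"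
  "i \<noteq> e \<Longrightarrow> 1 + (Im (z $ i))\<^sup>2 \<le> 4 * cmod (flat_rho2 e 1 z)"
proof -
  let ?S = "\<Sum>i\<in>UNIV - {e}. (cmod (z $ i))\<^sup>2"
  have S: "0 \<le> ?S" by (intro sum_nonneg) auto
  have A: "2 * Im (z $ e) + 2 + ?S \<le> 4 * cmod (flat_rho2 e 1 z)"
    using complex_Re_le_cmod[of "flat_rho2 e 1 z"] by (simp add: flat_rho2_def)
  have B: "2 * \<bar>Re (z $ e)\<bar> \<le> 4 * cmod (flat_rho2 e 1 z)"
    using abs_Im_le_cmod[of "flat_rho2 e 1 z"] by (simp add: flat_rho2_def)
  show "1 + Im (z $ e) \<le> 4 * cmod (flat_rho2 e 1 z)" "1 + \<bar>Re (z $ e)\<bar> \<le> 4 * cmod (flat_rho2 e 1 z)"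
    using A B S z by linarith+
  assume "i \<noteq> e"
  then have "(cmod (z $ i))\<^sup>2 \<le> ?S" by (intro member_le_sum) auto
  then have "(Re (z $ i))\<^sup>2 + (Im (z $ i))\<^sup>2 \<le> ?S" by (simp add: cmod_power2)
  then show "1 + (Re (z $ i))\<^sup>2 \<le> 4 * cmod (flat_rho2 e 1 z)" "1 + (Im (z $ i))\<^sup>2 \<le> 4 * cmod (flat_rho2 e 1 z)"
    using A z zero_le_power2[of "Re (z $ i)"] zero_le_power2[of "Im (z $ i)"] by linarith+
qed

lemma cmod_flat_rho2_ge_half: "1 / 2 \<le> cmod (flat_rho2 e 1 z)"
proof -
  have "0 \<le> (\<Sum>i\<in>UNIV - {e}. (cmod (z $ i))\<^sup>2)" by (intro sum_nonneg) auto
  then show ?thesis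
    using complex_Re_le_cmod[of "flat_rho2 e 1 z"] z by (simp add: flat_rho2_def)
qed

end

text \<open>The exponent t is distributed over the 2n real coordinates. The convergence thresholds
  are 1 for Re z_n, s + 1 for Im z_n and 1/2 for each of the 2(n - 1) others, with sum n + 1 + s.
  The excess of t over this sum is divided equally, and \<epsilon> is one share. \<open>p i\<close>
  is the total exponent given to the complex coordinate i.\<close>

lemma FR_const_finite:
  fixes e :: "'n::finite"
  assumes s: "s > -1" and t: "t > real CARD('n) + 1 + s"
  shows "FR_const e s t < \<infinity>"
proof -
  define \<epsilon> where "\<epsilon> = (t - (real CARD('n) + 1 + s)) / (2 * real CARD('n))"
  have n: "real CARD('n) > 0" using zero_less_card_finite by simp
  have \<epsilon>: "\<epsilon> > 0" using t n by (simp add: \<epsilon>_def)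
  have \<epsilon>t: "t = real CARD('n) + 1 + s + 2 * real CARD('n) * \<epsilon>" using n by (simp add: \<epsilon>_def)
  define p where "p i = (if i = e then s + 2 + 2 * \<epsilon> else 1 + 2 * \<epsilon>)" for i
  have sum_p: "(\<Sum>i\<in>UNIV. p i) = t"
  proof -
    have "(\<Sum>i\<in>UNIV. p i) = (s + 2 + 2 * \<epsilon>) + (\<Sum>i\<in>UNIV - {e}. 1 + 2 * \<epsilon>)"
      by (subst sum.remove[of _ e]) (auto simp: p_def intro!: sum.cong)
    also have "\<dots> = t"
      using n by (simp add: card_Diff_singleton of_nat_diff \<epsilon>t algebra_simps Suc_le_eq)
    finally show ?thesis .
  qed
  define f where "f i x = (if i = e then ennreal ((1 + \<bar>x\<bar>) powr - (1 + \<epsilon>)) else ennreal ((1 + x\<^sup>2) powr - (1/2 + \<epsilon>)))" for i and x :: real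
  define g where "g i y = (if i = e then ennreal (y powr s * (1 + y) powr - (s + 1 + \<epsilon>)) * indicator {0<..} y
      else ennreal ((1 + y\<^sup>2) powr - (1/2 + \<epsilon>)))" for i and y :: real
  have [measurable]: "f i \<in> borel_measurable borel" "g i \<in> borel_measurable borel" for i
    unfolding f_def[abs_def] g_def[abs_def] by measurable
  have bound: "flat_integrand e s t 1 z \<le> ennreal (4 powr t) * (\<Prod>i\<in>UNIV. f i (Re (z $ i)) * g i (Im (z $ i)))" for z
  proof (cases "0 < Im (z $ e)")
    case True
    note ge = cmod_flat_rho2_ge[OF True]
    define M where "M = 4 * cmod (flat_rho2 e 1 z)"
    have M: "M > 0" using ge(1) True unfolding M_def by linarith
    \<comment> \<open>Splits one complex coordinate's share between its real and its imaginary part;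
      negative powers reverse the lower bounds for \<open>M\<close>.\<close>
    have anti: "M powr - (a + b) \<le> x powr - a * y powr - b"
      if "0 < x" "x \<le> M" "0 < y" "y \<le> M" "0 \<le> a" "0 \<le> b" for x y a b
    proof -
      have "M powr - (a + b) = M powr - a * M powr - b" by (simp flip: powr_add)
      also have "\<dots> \<le> x powr - a * y powr - b"
        using that by (intro mult_mono powr_mono2') auto
      finally show ?thesis .
    qed
    have sq: "0 < 1 + x\<^sup>2" for x :: real by (simp add: add_pos_nonneg)
    have factor: "ennreal (M powr - p i * (if i = e then Im (z $ e) powr s else 1)) \<le> f i (Re (z $ i)) * g i (Im (z $ i))" for i
    proof (cases "i = e")
      case True
      have "M powr - (1 + \<epsilon> + (s + 1 + \<epsilon>)) \<le> (1 + \<bar>Re (z $ e)\<bar>) powr - (1 + \<epsilon>) * (1 + Im (z $ e)) powr - (s + 1 + \<epsilon>)"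
        using ge \<open>0 < Im (z $ e)\<close> \<epsilon> s by (intro anti) (auto simp: M_def)
      then have "M powr - (1 + \<epsilon> + (s + 1 + \<epsilon>)) * Im (z $ e) powr s
          \<le> (1 + \<bar>Re (z $ e)\<bar>) powr - (1 + \<epsilon>) * (1 + Im (z $ e)) powr - (s + 1 + \<epsilon>) * Im (z $ e) powr s"
        by (intro mult_right_mono) auto
      moreover have "1 + \<epsilon> + (s + 1 + \<epsilon>) = p e" by (simp add: p_def)
      ultimately show ?thesis
        using True \<open>0 < Im (z $ e)\<close>
        by (simp add: f_def g_def mult_ac flip: ennreal_mult)
    next
      case False
      have "M powr - (1/2 + \<epsilon> + (1/2 + \<epsilon>)) \<le> (1 + (Re (z $ i))\<^sup>2) powr - (1/2 + \<epsilon>) * (1 + (Im (z $ i))\<^sup>2) powr - (1/2 + \<epsilon>)"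
        using ge(3,4)[of i] False sq \<epsilon> by (intro anti) (auto simp: M_def)
      moreover have "1/2 + \<epsilon> + (1/2 + \<epsilon>) = p i" using False by (simp add: p_def)
      ultimately show ?thesis
        using False by (simp add: f_def g_def flip: ennreal_mult)
    qed
    have "Im (z $ e) powr s / cmod (flat_rho2 e 1 z) powr t = 4 powr t * (M powr - t * Im (z $ e) powr s)"
    proof -
      have "M powr - t = 4 powr - t * cmod (flat_rho2 e 1 z) powr - t"
        by (simp add: M_def powr_mult)
      then show ?thesis by (simp add: powr_minus field_simps)
    qed
    also have "M powr - t * Im (z $ e) powr s = (\<Prod>i\<in>UNIV. M powr - p i * (if i = e then Im (z $ e) powr s else 1))"
    proof -
      have "M powr - t = (\<Prod>i\<in>UNIV. M powr - p i)"
        using M sum_p powr_sum[where x = M and A = UNIV and f = "\<lambda>i. - p i"] by (simp add: sum_negf)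
      then show ?thesis by (simp add: prod.distrib)
    qed
    finally have "flat_integrand e s t 1 z
        = ennreal (4 powr t) * (\<Prod>i\<in>UNIV. ennreal (M powr - p i * (if i = e then Im (z $ e) powr s else 1)))"
      using True by (subst prod_ennreal) (auto simp: flat_integrand_def prod_nonneg simp flip: ennreal_mult)
    also have "\<dots> \<le> ennreal (4 powr t) * (\<Prod>i\<in>UNIV. f i (Re (z $ i)) * g i (Im (z $ i)))"
      by (intro mult_left_mono prod_mono_ennreal factor) auto
    finally show ?thesis .
  qed (simp add: flat_integrand_def)
  have "FR_const e s t \<le> (\<integral>\<^sup>+z. ennreal (4 powr t) * (\<Prod>i\<in>UNIV. f i (Re (z $ i)) * g i (Im (z $ i))) \<partial>lborel)"
    unfolding FR_const_def by (intro nn_integral_mono bound)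
  also have "\<dots> = ennreal (4 powr t) * (\<Prod>i\<in>UNIV. (\<integral>\<^sup>+x. f i x \<partial>lborel) * (\<integral>\<^sup>+x. g i x \<partial>lborel))"
    by (subst nn_integral_cmult) (auto simp: nn_integral_lborel_prod_complex_vec)
  also have "\<dots> < \<infinity>"
  proof -
    have "(\<integral>\<^sup>+x. f i x \<partial>lborel) < \<infinity>" "(\<integral>\<^sup>+x. g i x \<partial>lborel) < \<infinity>" for i
      using nn_integral_one_plus_abs_powr[of "- (1 + \<epsilon>)"] nn_integral_one_plus_square_powr[of "- (1/2 + \<epsilon>)"]
        nn_integral_powr_one_plus_powr[OF s \<epsilon>] \<epsilon>
      by (cases "i = e"; simp add: f_def g_def)+
    then have "(\<Prod>i\<in>UNIV. (\<integral>\<^sup>+x. f i x \<partial>lborel) * (\<integral>\<^sup>+x. g i x \<partial>lborel)) < top"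
      by (auto simp: less_top[symmetric] ennreal_prod_eq_top ennreal_mult_eq_top_iff)
    then show ?thesis by (simp add: ennreal_mult_less_top)
  qed
  finally show ?thesis .
qed

section \<open>Positivity and divergence of the Forelli-Rudin constant\<close>

lemma not_AE_lborel_notin_open:
  assumes "open S" "S \<noteq> {}"
  shows "\<not> (AE x in lborel. x \<notin> S)"
proof
  assume "AE x in lborel. x \<notin> S"
  then have "S \<in> null_sets lborel"
    using assms by (subst (asm) AE_iff_null_sets[symmetric]) (auto simp: borel_open)
  then have "negligible S"
    by (simp add: negligible_iff_null_sets null_sets_completionI)
  then show False using open_not_negligible assms by blast
qed

lemma FR_const_pos: "FR_const (e :: 'n::finite) s t \<noteq> 0"
proof
  assume "FR_const e s t = 0"
  then have "AE z in lborel. flat_integrand e s t 1 z = 0"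
    unfolding FR_const_def by (subst (asm) nn_integral_0_iff_AE) auto
  then have "AE z in lborel. z \<notin> {z :: complex^'n. 0 < Im (z $ e)}"
  proof (rule eventually_mono)
    fix z :: "complex^'n"
    assume "flat_integrand e s t 1 z = 0"
    then show "z \<notin> {z. 0 < Im (z $ e)}"
      using cmod_flat_rho2_ge_half[of z e] by (auto simp: flat_integrand_def ennreal_eq_0_iff divide_le_0_iff)
  qed
  moreover have "open {z :: complex^'n. 0 < Im (z $ e)}"
    by (intro open_Collect_less continuous_intros)
  moreover have "axis e \<i> \<in> {z :: complex^'n. 0 < Im (z $ e)}" by (simp add: axis_def)
  ultimately show False using not_AE_lborel_notin_open by blast
qed

text \<open>A minorant that is a product over the real coordinates has a product integral. One
  infinite factor makes it infinite as long as no factor is 0, because 0 * top = 0; hence the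
  conditions \<open>nz\<close>.\<close>

lemma FR_const_topI:
  fixes f g :: "'n::finite \<Rightarrow> real \<Rightarrow> ennreal"
  assumes [measurable]: "\<And>i. f i \<in> borel_measurable borel" "\<And>i. g i \<in> borel_measurable borel"
    and c: "c > 0"
    and le: "\<And>z. ennreal c * (\<Prod>i\<in>UNIV. f i (Re (z $ i)) * g i (Im (z $ i))) \<le> flat_integrand e s t 1 z"
    and nz: "\<And>i. (\<integral>\<^sup>+x. f i x \<partial>lborel) \<noteq> 0" "\<And>i. (\<integral>\<^sup>+x. g i x \<partial>lborel) \<noteq> 0"
    and top: "(\<integral>\<^sup>+x. f e x \<partial>lborel) = \<infinity> \<or> (\<integral>\<^sup>+x. g e x \<partial>lborel) = \<infinity>"
  shows "FR_const e s t = \<infinity>"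
proof -
  have "(\<Prod>i\<in>UNIV. (\<integral>\<^sup>+x. f i x \<partial>lborel) * (\<integral>\<^sup>+x. g i x \<partial>lborel)) = \<infinity>"
    using nz top by (auto simp: ennreal_prod_eq_top ennreal_mult_eq_top_iff)
  then have "\<infinity> = ennreal c * (\<Prod>i\<in>UNIV. (\<integral>\<^sup>+x. f i x \<partial>lborel) * (\<integral>\<^sup>+x. g i x \<partial>lborel))"
    using c by (simp add: ennreal_mult_top)
  also have "\<dots> = (\<integral>\<^sup>+z. ennreal c * (\<Prod>i\<in>UNIV. f i (Re (z $ i)) * g i (Im (z $ i))) \<partial>lborel)"
    by (subst nn_integral_cmult) (auto simp: nn_integral_lborel_prod_complex_vec)
  also have "\<dots> \<le> FR_const e s t"
    unfolding FR_const_def by (intro nn_integral_mono le)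
  finally show ?thesis by (simp add: top_unique)
qed

text \<open>On the unit cube the modulus of the flattened kernel stays between two positive
  constants, so only the factor (Im z_n)^s matters, and it is not integrable at the face Im z_n =
  0.\<close>

lemma FR_const_top_s:
  fixes e :: "'n::finite"
  assumes s: "s \<le> -1"
  shows "FR_const e s t = \<infinity>"
proof -
  \<comment> \<open>An upper bound for the modulus on the unit cube; the lower bound is 1/2. The
    minimum in \<open>c\<close> serves both signs of t.\<close>
  define h where "h = real CARD('n) + 2"
  define c where "c = min ((1/2) powr - t) (h powr - t)"
  define f where "f i x = (indicator {0..1} x :: ennreal)" for i :: 'n and x :: real
  define g where "g i y = (if i = e then ennreal (y powr s) * indicator {0<..1} y else indicator {0..1} y)" for i and y :: real
  have [measurable]: "f i \<in> borel_measurable borel" "g i \<in> borel_measurable borel" for i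
    unfolding f_def[abs_def] g_def[abs_def] by measurable
  have h: "h > 1/2" by (simp add: h_def)
  have c: "c > 0" using h by (simp add: c_def)
  show ?thesis
  proof (rule FR_const_topI[of f g c])
    fix z :: "complex^'n"
    show "ennreal c * (\<Prod>i\<in>UNIV. f i (Re (z $ i)) * g i (Im (z $ i))) \<le> flat_integrand e s t 1 z"
    proof (cases "\<forall>i. f i (Re (z $ i)) * g i (Im (z $ i)) \<noteq> 0")
      case True
      then have box: "0 \<le> Re (z $ i)" "Re (z $ i) \<le> 1" "0 \<le> Im (z $ i)" "Im (z $ i) \<le> 1" for i
        by (auto simp: f_def g_def indicator_def split: if_splits dest!: spec[of _ i])
      have pos: "0 < Im (z $ e)"
        using True by (auto simp: g_def indicator_def split: if_splits dest!: spec[of _ e])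
      have "(\<Prod>i\<in>UNIV. f i (Re (z $ i)) * g i (Im (z $ i))) = (\<Prod>i\<in>UNIV. if i = e then ennreal (Im (z $ e) powr s) else 1)"
        using box pos by (intro prod.cong) (auto simp: f_def g_def indicator_def)
      then have prod: "(\<Prod>i\<in>UNIV. f i (Re (z $ i)) * g i (Im (z $ i))) = ennreal (Im (z $ e) powr s)" by simp
      have "(\<Sum>i\<in>UNIV - {e}. (cmod (z $ i))\<^sup>2) \<le> (\<Sum>i\<in>UNIV - {e}. 2)"
      proof (rule sum_mono)
        fix i
        have "(Re (z $ i))\<^sup>2 \<le> 1" "(Im (z $ i))\<^sup>2 \<le> 1" using box[of i] by (auto simp: power_le_one)
        then show "(cmod (z $ i))\<^sup>2 \<le> 2" by (simp add: cmod_power2)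
      qed
      also have "\<dots> \<le> 2 * real CARD('n)" by (simp add: card_Diff_singleton of_nat_diff Suc_le_eq)
      finally have S: "(\<Sum>i\<in>UNIV - {e}. (cmod (z $ i))\<^sup>2) \<le> 2 * real CARD('n)" .
      have "cmod (flat_rho2 e 1 z) \<le> \<bar>Re (flat_rho2 e 1 z)\<bar> + \<bar>Im (flat_rho2 e 1 z)\<bar>"
        by (rule cmod_le)
      also have "\<dots> \<le> h"
        using S box[of e] sum_nonneg[of "UNIV - {e}" "\<lambda>i. (cmod (z $ i))\<^sup>2"] by (simp add: flat_rho2_def h_def field_simps)
      finally have le: "cmod (flat_rho2 e 1 z) \<le> h" .
      have "c \<le> cmod (flat_rho2 e 1 z) powr - t"
      proof (cases "t \<ge> 0")
        case True
        then have "h powr - t \<le> cmod (flat_rho2 e 1 z) powr - t"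
          using le cmod_flat_rho2_ge_half[OF pos] by (intro powr_mono2') auto
        then show ?thesis by (simp add: c_def)
      next
        case False
        then have "(1/2) powr - t \<le> cmod (flat_rho2 e 1 z) powr - t"
          using cmod_flat_rho2_ge_half[OF pos] by (intro powr_mono2) auto
        then show ?thesis by (simp add: c_def)
      qed
      then have "c * Im (z $ e) powr s \<le> cmod (flat_rho2 e 1 z) powr - t * Im (z $ e) powr s"
        by (intro mult_right_mono) auto
      then show ?thesis
        unfolding prod using pos c
        by (simp add: flat_integrand_def powr_minus field_simps flip: ennreal_mult)
    next
      case False
      then have "(\<Prod>i\<in>UNIV. f i (Re (z $ i)) * g i (Im (z $ i))) = 0" by (intro prod_zero) auto
      then show ?thesis by (simp only: mult_zero_right zero_le)
    qed
  next
    fix i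
    show "(\<integral>\<^sup>+x. g i x \<partial>lborel) \<noteq> 0"
      using nn_integral_powr_0_1_top[OF s] by (cases "i = e") (simp_all add: g_def)
    show "(\<integral>\<^sup>+x. f i x \<partial>lborel) \<noteq> 0" by (simp add: f_def)
  next
    show "(\<integral>\<^sup>+x. f e x \<partial>lborel) = \<infinity> \<or> (\<integral>\<^sup>+x. g e x \<partial>lborel) = \<infinity>"
      using nn_integral_powr_0_1_top[OF s] by (simp add: g_def)
  qed (use c in auto)
qed

text \<open>With t <= 0 the integrand is bounded below by a positive constant where 1 <= Im z_n <=
  2. Re z_n is left unrestricted there, so the minorant lives on a set of infinite measure.\<close>

lemma FR_const_top_t:
  fixes e :: "'n::finite"
  assumes t: "t \<le> 0"
  shows "FR_const e s t = \<infinity>"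
proof -
  define m where "m = min 1 (2 powr s)"
  define c where "c = (1/2) powr - t * m"
  define f where "f i x = (if i = e then 1 else indicator {0..1} x :: ennreal)" for i and x :: real
  define g where "g i y = (if i = e then indicator {1..2} y else indicator {0..1} y :: ennreal)" for i and y :: real
  have [measurable]: "f i \<in> borel_measurable borel" "g i \<in> borel_measurable borel" for i
    unfolding f_def[abs_def] g_def[abs_def] by measurable
  have c: "c > 0" by (simp add: c_def m_def)
  show ?thesis
  proof (rule FR_const_topI[of f g c])
    fix z :: "complex^'n"
    show "ennreal c * (\<Prod>i\<in>UNIV. f i (Re (z $ i)) * g i (Im (z $ i))) \<le> flat_integrand e s t 1 z"
    proof (cases "Im (z $ e) \<in> {1..2}")
      case True
      then have pos: "0 < Im (z $ e)" by simp
      have "(\<Prod>i\<in>UNIV. f i (Re (z $ i)) * g i (Im (z $ i))) \<le> (\<Prod>i\<in>(UNIV::'n set). 1)"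
        by (intro prod_mono_ennreal) (auto simp: f_def g_def indicator_def)
      then have "ennreal c * (\<Prod>i\<in>UNIV. f i (Re (z $ i)) * g i (Im (z $ i))) \<le> ennreal c * 1"
        by (intro mult_left_mono) auto
      also have "\<dots> \<le> ennreal (cmod (flat_rho2 e 1 z) powr - t * Im (z $ e) powr s)"
      proof -
        have "(1/2) powr - t \<le> cmod (flat_rho2 e 1 z) powr - t"
          using t cmod_flat_rho2_ge_half[OF pos] by (intro powr_mono2) auto
        moreover have "m \<le> Im (z $ e) powr s"
        proof (cases "s \<ge> 0")
          case True
          then have "1 \<le> Im (z $ e) powr s" using \<open>Im (z $ e) \<in> {1..2}\<close> by (simp add: ge_one_powr_ge_zero)
          then show ?thesis by (simp add: m_def)
        next
          case False
          then have "2 powr s \<le> Im (z $ e) powr s" using \<open>Im (z $ e) \<in> {1..2}\<close> by (intro powr_mono2') auto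
          then show ?thesis by (simp add: m_def)
        qed
        ultimately show ?thesis
          unfolding c_def by (auto intro!: ennreal_leI mult_mono simp: m_def)
      qed
      finally show ?thesis using pos by (simp add: flat_integrand_def powr_minus field_simps)
    next
      case False
      then have "f e (Re (z $ e)) * g e (Im (z $ e)) = 0" by (simp add: g_def)
      then have "(\<Prod>i\<in>UNIV. f i (Re (z $ i)) * g i (Im (z $ i))) = 0" by (intro prod_zero) auto
      then show ?thesis by (simp only: mult_zero_right zero_le)
    qed
  next
    fix i
    show "(\<integral>\<^sup>+x. g i x \<partial>lborel) \<noteq> 0" "(\<integral>\<^sup>+x. f i x \<partial>lborel) \<noteq> 0"
      by (cases "i = e"; simp add: f_def g_def)+
  next
    show "(\<integral>\<^sup>+x. f e x \<partial>lborel) = \<infinity> \<or> (\<integral>\<^sup>+x. g e x \<partial>lborel) = \<infinity>"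
      by (simp add: f_def)
  qed (use c in auto)
qed

text \<open>For \<open>t > 0\<close> the integral over the half space decreases strictly in the height \<open>R\<close>; since it is
  homogeneous in \<open>R\<close>, finiteness forces its degree to be negative.\<close>

lemma FR_const_finiteD:
  fixes e :: "'n::finite"
  assumes fin: "FR_const e s t \<noteq> \<infinity>"
  shows "s > -1" "t > real CARD('n) + 1 + s"
proof -
  show "s > -1" using fin FR_const_top_s[of s e t] by force
  have t: "t > 0" using fin FR_const_top_t[of t e s] by force
  let ?d = "real CARD('n) + 1 + s - t"
  show "t > real CARD('n) + 1 + s"
  proof (rule ccontr)
    assume "\<not> ?thesis"
    then have d: "?d \<ge> 0" by simp
    let ?f1 = "flat_integrand e s t 1" and ?f2 = "flat_integrand e s t 2"
    have less: "?f2 z < ?f1 z" if z: "0 < Im (z $ e)" for z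
    proof -
      have "cmod (flat_rho2 e 1 z) < cmod (flat_rho2 e 2 z)"
      proof -
        have "0 \<le> (\<Sum>i\<in>UNIV - {e}. (cmod (z $ i))\<^sup>2)" by (intro sum_nonneg) auto
        then have "0 < Re (flat_rho2 e 1 z)" "Re (flat_rho2 e 1 z) < Re (flat_rho2 e 2 z)"
          using z by (auto simp: flat_rho2_def)
        then have "(Re (flat_rho2 e 1 z))\<^sup>2 < (Re (flat_rho2 e 2 z))\<^sup>2"
          by (intro power_strict_mono) auto
        moreover have "Im (flat_rho2 e 1 z) = Im (flat_rho2 e 2 z)" by (simp add: flat_rho2_def)
        ultimately show ?thesis unfolding cmod_def by simp
      qed
      then have "cmod (flat_rho2 e 1 z) powr t < cmod (flat_rho2 e 2 z) powr t" "0 < cmod (flat_rho2 e 1 z) powr t"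
        using t cmod_flat_rho2_ge_half[OF z] by (auto intro!: powr_less_mono2)
      then have "Im (z $ e) powr s / cmod (flat_rho2 e 2 z) powr t < Im (z $ e) powr s / cmod (flat_rho2 e 1 z) powr t"
        using z by (intro divide_strict_left_mono mult_pos_pos) auto
      then show ?thesis
        using z by (simp add: flat_integrand_def ennreal_less_iff)
    qed
    have le: "?f2 z \<le> ?f1 z" for z
    proof (cases "0 < Im (z $ e)")
      case True
      then show ?thesis by (intro less_imp_le less)
    qed (simp add: flat_integrand_def)
    have "1 \<le> (2::real) powr ?d" using d by (intro ge_one_powr_ge_zero) auto
    then have "1 * FR_const e s t \<le> ennreal (2 powr ?d) * FR_const e s t"
      by (intro mult_right_mono) auto
    then have ge: "FR_const e s t \<le> (\<integral>\<^sup>+z. ?f2 z \<partial>lborel)"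
      by (simp add: nn_integral_flat_integrand)
    have le': "(\<integral>\<^sup>+z. ?f2 z \<partial>lborel) \<le> FR_const e s t"
      unfolding FR_const_def by (intro nn_integral_mono le)
    have "(\<integral>\<^sup>+z. ?f1 z - ?f2 z \<partial>lborel) = (\<integral>\<^sup>+z. ?f1 z \<partial>lborel) - (\<integral>\<^sup>+z. ?f2 z \<partial>lborel)"
      using le le' fin by (intro nn_integral_diff) (auto simp: top_unique)
    also have "\<dots> = 0"
      using ge fin by (simp add: FR_const_def[symmetric] diff_eq_0_iff_ennreal less_top)
    finally have "AE z in lborel. ?f1 z - ?f2 z = 0"
      by (subst (asm) nn_integral_0_iff_AE) auto
    then have "AE z in lborel. z \<notin> {z :: complex^'n. 0 < Im (z $ e)}"
      by (rule eventually_mono) (use less in \<open>auto simp: diff_eq_0_iff_ennreal dest: leD\<close>)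
    moreover have "open {z :: complex^'n. 0 < Im (z $ e)}"
      by (intro open_Collect_less continuous_intros)
    moreover have "axis e \<i> \<in> {z :: complex^'n. 0 < Im (z $ e)}" by (simp add: axis_def)
    ultimately show False using not_AE_lborel_notin_open by blast
  qed
qed

subsection \<open>The weighted measures\<close>

lemma space_PP [simp]: "space (PP e) = TB e \<times> TB e"
  by (simp add: PP_def space_restrict_space space_pair_measure)

lemma TB2_sets [measurable]: "TB e \<times> TB e \<in> sets (lborel \<Otimes>\<^sub>M lborel)"
  by (intro pair_measureI) auto

lemma nn_integral_PP: "(\<integral>\<^sup>+y. F y \<partial>PP e) = (\<integral>\<^sup>+y. F y * indicator (TB e \<times> TB e) y \<partial>(lborel \<Otimes>\<^sub>M lborel))"
  unfolding PP_def using TB2_sets[of e] by (intro nn_integral_restrict_space) (simp add: space_pair_measure)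

text \<open>Extension by zero moves measurability to the product of full Lebesgue measures, where
  sections and Tonelli are available.\<close>

lemma borel_measurable_PP_iff:
  "F \<in> borel_measurable (PP e) \<longleftrightarrow> (\<lambda>y. F y * indicator (TB e \<times> TB e) y) \<in> borel_measurable (lborel \<Otimes>\<^sub>M lborel)"
  for F :: "_ \<Rightarrow> ennreal"
  unfolding PP_def using TB2_sets[of e] by (intro borel_measurable_restrict_space_iff_ennreal) (simp add: space_pair_measure)

lemma space_Vw [simp]: "space (Vw e \<beta>) = TB e"
  by (simp add: Vw_def space_restrict_space)

lemma sets_Vw: "sets (Vw e \<beta>) = sets (restrict_space borel (TB e))"
  by (simp add: Vw_def sets_restrict_space)

lemma measurable_Vw [measurable (raw)]: "F \<in> measurable borel N \<Longrightarrow> F \<in> measurable (Vw e \<beta>) N"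
  by (simp add: sets_Vw measurable_restrict_space1 cong: measurable_cong_sets)

lemma nn_integral_Vw:
  assumes "F \<in> borel_measurable (restrict_space borel (TB e))"
  shows "(\<integral>\<^sup>+z. F z \<partial>Vw e \<beta>) = (\<integral>\<^sup>+z. ennreal (rho e z powr \<beta>) * F z * indicator (TB e) z \<partial>lborel)"
proof -
  have sets: "sets (restrict_space lborel (TB e)) = sets (restrict_space borel (TB e))"
    by (simp add: sets_restrict_space)
  have "F \<in> borel_measurable (restrict_space lborel (TB e))"
    using assms by (simp add: sets cong: measurable_cong_sets)
  moreover have "(\<lambda>z. ennreal (rho e z powr \<beta>)) \<in> borel_measurable (restrict_space lborel (TB e))"
    by (intro measurable_restrict_space1) measurable
  ultimately have "(\<integral>\<^sup>+z. F z \<partial>Vw e \<beta>) = (\<integral>\<^sup>+z. ennreal (rho e z powr \<beta>) * F z \<partial>restrict_space lborel (TB e))"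
    unfolding Vw_def by (intro nn_integral_density)
  also have "\<dots> = (\<integral>\<^sup>+z. ennreal (rho e z powr \<beta>) * F z * indicator (TB e) z \<partial>lborel)"
    by (intro nn_integral_restrict_space) simp
  finally show ?thesis .
qed

lemma sigma_finite_Vw: "sigma_finite_measure (Vw e \<beta>)"
proof -
  interpret sigma_finite_measure "restrict_space lborel (TB e)"
    by (intro sigma_finite_measure_restrict_space sigma_finite_lborel) simp
  have "(\<lambda>z. ennreal (rho e z powr \<beta>)) \<in> borel_measurable (restrict_space lborel (TB e))"
    by (intro measurable_restrict_space1) measurable
  then show ?thesis unfolding Vw_def by (subst sigma_finite_iff_density_finite) auto
qed

text \<open>Tonelli's theorem for the extension \<open>F\<close> of |f| by zero. In this form the
  source norm is the total mass of a measure on the product domain.\<close>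

lemma mnorm_1_1:
  assumes f[measurable]: "f \<in> borel_measurable (PP e)"
  shows "mnorm e 1 1 \<alpha>1 \<alpha>2 f
    = (\<integral>\<^sup>+y. ennreal (cmod (f y) * rho e (fst y) powr \<alpha>1 * rho e (snd y) powr \<alpha>2) \<partial>PP e)"
proof -
  define F where "F y = ennreal (cmod (f y)) * indicator (TB e \<times> TB e) y" for y
  have [measurable]: "F \<in> borel_measurable (lborel \<Otimes>\<^sub>M lborel)"
    unfolding F_def[abs_def] by (subst borel_measurable_PP_iff[symmetric]) measurable
  have sec: "(\<lambda>z. ennreal (cmod (f (z, w)))) \<in> borel_measurable (restrict_space borel (TB e))" if "w \<in> TB e" for w
  proof -
    have "(\<lambda>z. F (z, w)) \<in> borel_measurable (restrict_space borel (TB e))"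
      by (intro measurable_restrict_space1) measurable
    then show ?thesis
      using that by (subst measurable_cong[where g = "\<lambda>z. F (z, w)"]) (auto simp: F_def space_restrict_space)
  qed
  define G where "G w = (\<integral>\<^sup>+z. ennreal (rho e z powr \<alpha>1) * F (z, w) \<partial>lborel)" for w
  have [measurable]: "G \<in> borel_measurable borel" unfolding G_def[abs_def] by measurable
  have "mnorm e 1 1 \<alpha>1 \<alpha>2 f = (\<integral>\<^sup>+w. (\<integral>\<^sup>+z. ennreal (cmod (f (z, w))) \<partial>Vw e \<alpha>1) \<partial>Vw e \<alpha>2)"
    by (simp add: mnorm_def)
  also have "\<dots> = (\<integral>\<^sup>+w. G w \<partial>Vw e \<alpha>2)"
    by (intro nn_integral_cong)
       (auto simp: nn_integral_Vw[OF sec] G_def F_def indicator_def intro!: nn_integral_cong)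
  also have "\<dots> = (\<integral>\<^sup>+w. ennreal (rho e w powr \<alpha>2) * G w * indicator (TB e) w \<partial>lborel)"
    by (intro nn_integral_Vw measurable_restrict_space1) measurable
  also have "\<dots> = (\<integral>\<^sup>+w. \<integral>\<^sup>+z. ennreal (rho e w powr \<alpha>2) * indicator (TB e) w * (ennreal (rho e z powr \<alpha>1) * F (z, w)) \<partial>lborel \<partial>lborel)"
    unfolding G_def by (intro nn_integral_cong, subst nn_integral_cmult) (auto simp: mult_ac)
  also have "\<dots> = (\<integral>\<^sup>+y. ennreal (rho e (snd y) powr \<alpha>2) * indicator (TB e) (snd y) * (ennreal (rho e (fst y) powr \<alpha>1) * F y) \<partial>(lborel \<Otimes>\<^sub>M lborel))"
    using lborel_pair.nn_integral_snd[of "\<lambda>y. ennreal (rho e (snd y) powr \<alpha>2) * indicator (TB e) (snd y) * (ennreal (rho e (fst y) powr \<alpha>1) * F y)"] by simp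
  also have "\<dots> = (\<integral>\<^sup>+y. ennreal (cmod (f y) * rho e (fst y) powr \<alpha>1 * rho e (snd y) powr \<alpha>2) \<partial>PP e)"
    unfolding nn_integral_PP
    by (intro nn_integral_cong) (auto simp: F_def indicator_def ennreal_mult mult_ac)
  finally show ?thesis .
qed

text \<open>The modulus of one tensor factor of the kernel, with the outer weight \<rho>(z)^a
  absorbed.\<close>

definition wker :: "'n::finite \<Rightarrow> real \<Rightarrow> real \<Rightarrow> real \<Rightarrow> complex^'n \<Rightarrow> complex^'n \<Rightarrow> real" where
  "wker e a b c z u = rho e z powr a * rho e u powr b / cmod (rho2 e z u) powr c"

lemma wker_nonneg [simp]: "0 \<le> wker e a b c z u"
  by (simp add: wker_def)

lemma wker_pos: "z \<in> TB e \<Longrightarrow> u \<in> TB e \<Longrightarrow> 0 < wker e a b c z u"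
  using rho2_nz[of z e u] by (auto simp: wker_def TB_def)

lemma borel_measurable_wker [measurable (raw)]:
  assumes [measurable]: "f \<in> borel_measurable M" "g \<in> borel_measurable M"
  shows "(\<lambda>x. wker e a b c (f x) (g x)) \<in> borel_measurable M"
  unfolding wker_def by measurable

text \<open>The q-th power of the kernel is a Forelli-Rudin integrand with s = a q + \<beta> and t =
  c q. With b - \<alpha> in place of b, the vanishing of the exponent of \<open>rho e u\<close> is
  the homogeneity condition on which both directions of the equivalence turn.\<close>

lemma nn_integral_wker:
  fixes e :: "'n::finite"
  assumes u: "u \<in> TB e"
  shows "(\<integral>\<^sup>+z. ennreal (wker e a b c z u powr q) \<partial>Vw e \<beta>)
    = ennreal (rho e u powr (b * q + (real CARD('n) + 1 + (a * q + \<beta>) - c * q))) * FR_const e (a * q + \<beta>) (c * q)"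
proof -
  have ru: "0 < rho e u" using u by (simp add: TB_def)
  have "(\<integral>\<^sup>+z. ennreal (wker e a b c z u powr q) \<partial>Vw e \<beta>)
      = (\<integral>\<^sup>+z. ennreal (rho e z powr \<beta>) * ennreal (wker e a b c z u powr q) * indicator (TB e) z \<partial>lborel)"
    by (intro nn_integral_Vw measurable_restrict_space1) measurable
  also have "\<dots> = (\<integral>\<^sup>+z. ennreal (rho e u powr (b * q)) * (ennreal (rho e z powr (a * q + \<beta>) / cmod (rho2 e z u) powr (c * q)) * indicator (TB e) z) \<partial>lborel)"
  proof (intro nn_integral_cong)
    fix z
    show "ennreal (rho e z powr \<beta>) * ennreal (wker e a b c z u powr q) * indicator (TB e) z
        = ennreal (rho e u powr (b * q)) * (ennreal (rho e z powr (a * q + \<beta>) / cmod (rho2 e z u) powr (c * q)) * indicator (TB e) z)"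
    proof (cases "z \<in> TB e")
      case True
      have "wker e a b c z u powr q = rho e z powr (a * q) * rho e u powr (b * q) / cmod (rho2 e z u) powr (c * q)"
        by (simp add: wker_def powr_mult powr_divide powr_powr)
      then show ?thesis using True by (simp add: powr_add mult_ac flip: ennreal_mult)
    qed simp
  qed
  also have "\<dots> = ennreal (rho e u powr (b * q)) * (\<integral>\<^sup>+z. ennreal (rho e z powr (a * q + \<beta>) / cmod (rho2 e z u) powr (c * q)) * indicator (TB e) z \<partial>lborel)"
    by (intro nn_integral_cmult) measurable
  also have "\<dots> = ennreal (rho e u powr (b * q)) * (ennreal (rho e u powr (real CARD('n) + 1 + (a * q + \<beta>) - c * q)) * FR_const e (a * q + \<beta>) (c * q))"
    by (subst nn_integral_rho_rho2[OF u]) simp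
  finally show ?thesis by (simp add: powr_add ennreal_mult mult.assoc)
qed

text \<open>The weight is positive throughout the domain, so weighted and unweighted null sets
  coincide.\<close>

lemma AE_Vw: "(AE z in Vw e \<beta>. P z) \<longleftrightarrow> (AE z in lborel. z \<in> TB e \<longrightarrow> P z)"
proof -
  have "(\<lambda>z. ennreal (rho e z powr \<beta>)) \<in> borel_measurable (restrict_space lborel (TB e))"
    by (intro measurable_restrict_space1) measurable
  then have "(AE z in Vw e \<beta>. P z) \<longleftrightarrow> (AE z in restrict_space lborel (TB e). 0 < ennreal (rho e z powr \<beta>) \<longrightarrow> P z)"
    unfolding Vw_def by (rule AE_density)
  also have "\<dots> \<longleftrightarrow> (AE z in lborel. z \<in> TB e \<longrightarrow> (0 < ennreal (rho e z powr \<beta>) \<longrightarrow> P z))"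
    by (rule AE_restrict_space_iff) simp
  also have "\<dots> \<longleftrightarrow> (AE z in lborel. z \<in> TB e \<longrightarrow> P z)"
    by (intro arg_cong2[where f = eventually] ext refl) (auto simp: TB_def)
  finally show ?thesis .
qed

lemma measurable_fst_PP [measurable]: "fst \<in> borel_measurable (PP e)"
  unfolding PP_def by (intro measurable_restrict_space1) measurable

lemma measurable_snd_PP [measurable]: "snd \<in> borel_measurable (PP e)"
  unfolding PP_def by (intro measurable_restrict_space1) measurable

text \<open>The equations \<open>deg\<close> make the column norms of the reweighted kernel
  independent of (u,\<eta>), with values given by the constants \<open>B1\<close> and
  \<open>B2\<close>. One estimate for the integral of |K f| then yields both the convergence almost
  everywhere and the norm bound.\<close>

lemma bounded_op_if_FR_const_finite:
  fixes e :: "'n::finite"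
  assumes q: "1 \<le> q1" "1 \<le> q2"
    and K_norm: "\<And>z w u \<eta>. z \<in> TB e \<Longrightarrow> w \<in> TB e \<Longrightarrow> u \<in> TB e \<Longrightarrow> \<eta> \<in> TB e \<Longrightarrow>
        rho e z powr a1 * rho e w powr a2 * cmod (K (z, w) (u, \<eta>)) = wker e a1 b1 c1 z u * wker e a2 b2 c2 w \<eta>"
    and K_meas: "\<And>x. x \<in> TB e \<times> TB e \<Longrightarrow> K x \<in> borel_measurable (PP e)"
    and deg: "(b1 - \<alpha>1) * q1 + (real CARD('n) + 1 + (a1 * q1 + \<beta>1) - c1 * q1) = 0"
        "(b2 - \<alpha>2) * q2 + (real CARD('n) + 1 + (a2 * q2 + \<beta>2) - c2 * q2) = 0"
    and fin: "FR_const e (a1 * q1 + \<beta>1) (c1 * q1) \<noteq> \<infinity>" "FR_const e (a2 * q2 + \<beta>2) (c2 * q2) \<noteq> \<infinity>"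
  shows "bounded_op e a1 a2 K 1 1 \<alpha>1 \<alpha>2 q1 q2 \<beta>1 \<beta>2"
proof -
  define B1 where "B1 = FR_const e (a1 * q1 + \<beta>1) (c1 * q1)"
  define B2 where "B2 = FR_const e (a2 * q2 + \<beta>2) (c2 * q2)"
  define C where "C = enn2real (enn_powr (enn_powr B1 (q2 / q1) * B2) (1 / q2))"
  have BB: "enn_powr B1 (q2 / q1) * B2 \<noteq> \<infinity>"
    using fin by (simp add: B1_def B2_def ennreal_mult_eq_top_iff)
  then have C: "ennreal C = enn_powr (enn_powr B1 (q2 / q1) * B2) (1 / q2)"
    unfolding C_def by (subst ennreal_enn2real) (auto simp: less_top[symmetric])
  interpret V1: sigma_finite_measure "Vw e \<beta>1" by (rule sigma_finite_Vw)
  interpret V2: sigma_finite_measure "Vw e \<beta>2" by (rule sigma_finite_Vw)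
  have main: "(AE x in PP e. integrable (PP e) (\<lambda>y. K x y * f y)) \<and>
        mnorm e q1 q2 \<beta>1 \<beta>2 (intop e a1 a2 K f) \<le> ennreal C * mnorm e 1 1 \<alpha>1 \<alpha>2 f"
    if f: "inL e 1 1 \<alpha>1 \<alpha>2 f" for f
  proof -
    have [measurable]: "f \<in> borel_measurable (PP e)" using f by (simp add: inL_def)
    \<comment> \<open>The mass of \<open>\<mu>\<close> is the source norm of f. Its weights are
      compensated by lowering b1 and b2 by \<alpha>1 and \<alpha>2 in the kernels below.\<close>
    define \<mu> where "\<mu> = density (PP e) (\<lambda>y. ennreal (cmod (f y) * rho e (fst y) powr \<alpha>1 * rho e (snd y) powr \<alpha>2))"
    define N where "N = mnorm e 1 1 \<alpha>1 \<alpha>2 f"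
    have N: "N < \<infinity>" using f by (simp add: inL_def N_def)
    have space\<mu>: "space \<mu> = TB e \<times> TB e" by (simp add: \<mu>_def)
    have \<mu>N: "emeasure \<mu> (space \<mu>) = N"
      unfolding N_def mnorm_1_1[OF \<open>f \<in> borel_measurable (PP e)\<close>] \<mu>_def
      using sets.top[of "PP e"]
      by (subst emeasure_density) (auto intro!: nn_integral_cong simp: indicator_def)
    interpret \<mu>: finite_measure \<mu>
      using N \<mu>N by (intro finite_measureI) auto
    have [measurable]: "fst \<in> borel_measurable \<mu>" "snd \<in> borel_measurable \<mu>"
      unfolding \<mu>_def by measurable
    define \<kappa>1 where "\<kappa>1 p = ennreal (wker e a1 (b1 - \<alpha>1) c1 (fst p) (fst (snd p)))"
      for p :: "(complex^'n) \<times> (complex^'n) \<times> (complex^'n)"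
    define \<kappa>2 where "\<kappa>2 p = ennreal (wker e a2 (b2 - \<alpha>2) c2 (fst p) (snd (snd p)))"
      for p :: "(complex^'n) \<times> (complex^'n) \<times> (complex^'n)"
    have \<kappa>_borel[measurable]: "\<kappa>1 \<in> borel_measurable (borel \<Otimes>\<^sub>M \<mu>)" "\<kappa>2 \<in> borel_measurable (borel \<Otimes>\<^sub>M \<mu>)"
      unfolding \<kappa>1_def[abs_def] \<kappa>2_def[abs_def] by measurable
    have [measurable]: "(\<lambda>z. z) \<in> borel_measurable (Vw e \<beta>)" for \<beta> by (rule measurable_Vw) simp
    have \<kappa>_Vw: "\<kappa>1 \<in> borel_measurable (Vw e \<beta>1 \<Otimes>\<^sub>M \<mu>)" "\<kappa>2 \<in> borel_measurable (Vw e \<beta>2 \<Otimes>\<^sub>M \<mu>)"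
      unfolding \<kappa>1_def[abs_def] \<kappa>2_def[abs_def] by measurable
    \<comment> \<open>\<open>K\<close> is only known to be measurable in its second argument. On the
      domain \<open>\<Phi>\<close> agrees with the weighted integral of |K f|, and it is jointly
      measurable in z and w by construction.\<close>
    define \<Phi> where "\<Phi> z w = (\<integral>\<^sup>+y. \<kappa>1 (z, y) * \<kappa>2 (w, y) \<partial>\<mu>)" for z w
    have [measurable]: "case_prod \<Phi> \<in> borel_measurable (borel \<Otimes>\<^sub>M borel)"
      unfolding \<Phi>_def[abs_def] by measurable
    then have [measurable]: "(\<lambda>x. \<Phi> (fst x) (snd x)) \<in> borel_measurable (borel \<Otimes>\<^sub>M borel)"
      by (simp add: case_prod_beta')
    have \<Phi>_eq: "\<Phi> z w = ennreal (rho e z powr a1 * rho e w powr a2) * (\<integral>\<^sup>+y. ennreal (cmod (K (z, w) y * f y)) \<partial>PP e)"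
      if z: "z \<in> TB e" and w: "w \<in> TB e" for z w
    proof -
      have [measurable]: "K (z, w) \<in> borel_measurable (PP e)" using K_meas z w by simp
      have m: "(\<lambda>y. \<kappa>1 (z, y) * \<kappa>2 (w, y)) \<in> borel_measurable (PP e)"
        unfolding \<kappa>1_def \<kappa>2_def fst_conv snd_conv by measurable
      have "\<Phi> z w = (\<integral>\<^sup>+y. ennreal (cmod (f y) * rho e (fst y) powr \<alpha>1 * rho e (snd y) powr \<alpha>2) * (\<kappa>1 (z, y) * \<kappa>2 (w, y)) \<partial>PP e)"
        unfolding \<Phi>_def \<mu>_def using m by (intro nn_integral_density) auto
      also have "\<dots> = (\<integral>\<^sup>+y. ennreal (rho e z powr a1 * rho e w powr a2) * ennreal (cmod (K (z, w) y * f y)) \<partial>PP e)"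
      proof (intro nn_integral_cong)
        fix y assume y: "y \<in> space (PP e)"
        obtain u \<eta> where [simp]: "y = (u, \<eta>)" by (cases y)
        have u: "u \<in> TB e" "\<eta> \<in> TB e" using y by auto
        have 1: "wker e a1 b1 c1 z u = wker e a1 (b1 - \<alpha>1) c1 z u * rho e u powr \<alpha>1"
          using u by (simp add: wker_def TB_def powr_diff)
        have 2: "wker e a2 b2 c2 w \<eta> = wker e a2 (b2 - \<alpha>2) c2 w \<eta> * rho e \<eta> powr \<alpha>2"
          using u by (simp add: wker_def TB_def powr_diff)
        have "cmod (f y) * rho e (fst y) powr \<alpha>1 * rho e (snd y) powr \<alpha>2 * (wker e a1 (b1 - \<alpha>1) c1 z u * wker e a2 (b2 - \<alpha>2) c2 w \<eta>)
            = rho e z powr a1 * rho e w powr a2 * cmod (K (z, w) y * f y)"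
          using K_norm[OF z w u] unfolding 1 2 by (simp add: norm_mult mult_ac)
        then show "ennreal (cmod (f y) * rho e (fst y) powr \<alpha>1 * rho e (snd y) powr \<alpha>2) * (\<kappa>1 (z, y) * \<kappa>2 (w, y))
            = ennreal (rho e z powr a1 * rho e w powr a2) * ennreal (cmod (K (z, w) y * f y))"
          by (simp add: \<kappa>1_def \<kappa>2_def flip: ennreal_mult)
      qed
      also have "\<dots> = ennreal (rho e z powr a1 * rho e w powr a2) * (\<integral>\<^sup>+y. ennreal (cmod (K (z, w) y * f y)) \<partial>PP e)"
        by (intro nn_integral_cmult) measurable
      finally show ?thesis .
    qed
    have norm_\<kappa>1: "(\<integral>\<^sup>+z. enn_powr (\<kappa>1 (z, y)) q1 \<partial>Vw e \<beta>1) \<le> B1" if "y \<in> space \<mu>" for y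
    proof -
      have y: "fst y \<in> TB e" using that by (auto simp: space\<mu>)
      have "(\<integral>\<^sup>+z. enn_powr (\<kappa>1 (z, y)) q1 \<partial>Vw e \<beta>1) = (\<integral>\<^sup>+z. ennreal (wker e a1 (b1 - \<alpha>1) c1 z (fst y) powr q1) \<partial>Vw e \<beta>1)"
        by (simp add: \<kappa>1_def enn_powr_ennreal)
      also have "\<dots> = B1"
        using y unfolding nn_integral_wker[OF y] deg B1_def by (auto simp: TB_def)
      finally show ?thesis by simp
    qed
    have norm_\<kappa>2: "(\<integral>\<^sup>+w. enn_powr (\<kappa>2 (w, y)) q2 \<partial>Vw e \<beta>2) \<le> B2" if "y \<in> space \<mu>" for y
    proof -
      have y: "snd y \<in> TB e" using that by (auto simp: space\<mu>)
      have "(\<integral>\<^sup>+z. enn_powr (\<kappa>2 (z, y)) q2 \<partial>Vw e \<beta>2) = (\<integral>\<^sup>+z. ennreal (wker e a2 (b2 - \<alpha>2) c2 z (snd y) powr q2) \<partial>Vw e \<beta>2)"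
        by (simp add: \<kappa>2_def enn_powr_ennreal)
      also have "\<dots> = B2"
        using y unfolding nn_integral_wker[OF y] deg B2_def by (auto simp: TB_def)
      finally show ?thesis by simp
    qed
    have bound: "(\<integral>\<^sup>+w. enn_powr (\<integral>\<^sup>+z. enn_powr (\<Phi> z w) q1 \<partial>Vw e \<beta>1) (q2 / q1) \<partial>Vw e \<beta>2)
        \<le> enn_powr B1 (q2 / q1) * B2 * enn_powr N q2"
      unfolding \<Phi>_def \<mu>N[symmetric]
      by (rule nn_integral_tensor_kernel_le[OF sigma_finite_Vw sigma_finite_Vw \<mu>.finite_measure_axioms \<kappa>_Vw q _ norm_\<kappa>1 norm_\<kappa>2])
         (simp_all add: B1_def FR_const_pos)
    have le: "ennreal (cmod (intop e a1 a2 K f (z, w))) \<le> \<Phi> z w" if z: "z \<in> TB e" and w: "w \<in> TB e" for z w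
    proof -
      have "ennreal (cmod (integral\<^sup>L (PP e) (\<lambda>y. K (z, w) y * f y))) \<le> (\<integral>\<^sup>+y. ennreal (cmod (K (z, w) y * f y)) \<partial>PP e)"
      \<comment> \<open>Where the integral diverges the Bochner integral is 0 by convention, so the
        bound holds at every point and not just almost everywhere.\<close>
      proof (cases "integrable (PP e) (\<lambda>y. K (z, w) y * f y)")
        case True
        then show ?thesis by (rule integral_norm_bound_ennreal)
      qed (simp add: not_integrable_integral_eq)
      then show ?thesis
        unfolding \<Phi>_eq[OF z w] by (simp add: intop_def norm_mult ennreal_mult mult_left_mono)
    qed
    have "mnorm e q1 q2 \<beta>1 \<beta>2 (intop e a1 a2 K f)
        \<le> enn_powr (\<integral>\<^sup>+w. enn_powr (\<integral>\<^sup>+z. enn_powr (\<Phi> z w) q1 \<partial>Vw e \<beta>1) (q2 / q1) \<partial>Vw e \<beta>2) (1 / q2)"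
      unfolding mnorm_def using q
      by (intro enn_powr_mono nn_integral_mono) (auto simp flip: enn_powr_ennreal intro!: enn_powr_mono le)
    also have "\<dots> \<le> enn_powr (enn_powr B1 (q2 / q1) * B2 * enn_powr N q2) (1 / q2)"
      using q by (intro enn_powr_mono bound) auto
    also have "\<dots> = ennreal C * N"
      using q by (simp add: enn_powr_mult[of _ "enn_powr N q2"] enn_powr_powr C)
    finally have norm: "mnorm e q1 q2 \<beta>1 \<beta>2 (intop e a1 a2 K f) \<le> ennreal C * mnorm e 1 1 \<alpha>1 \<alpha>2 f"
      by (simp add: N_def)
    have \<Phi>_Vw[measurable]: "case_prod \<Phi> \<in> borel_measurable (Vw e \<beta>1 \<Otimes>\<^sub>M Vw e \<beta>2)"
      using measurable_compose[of "\<lambda>x. (fst x, snd x)" "Vw e \<beta>1 \<Otimes>\<^sub>M Vw e \<beta>2" "borel \<Otimes>\<^sub>M borel" "case_prod \<Phi>"] by simp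
    have "(\<integral>\<^sup>+w. enn_powr (\<integral>\<^sup>+z. enn_powr (\<Phi> z w) q1 \<partial>Vw e \<beta>1) (q2 / q1) \<partial>Vw e \<beta>2) \<noteq> \<infinity>"
      using bound BB N by (auto simp: top_unique ennreal_mult_eq_top_iff)
    then have "AE w in Vw e \<beta>2. enn_powr (\<integral>\<^sup>+z. enn_powr (\<Phi> z w) q1 \<partial>Vw e \<beta>1) (q2 / q1) \<noteq> \<infinity>"
      by (intro nn_integral_noteq_infinite) measurable
    moreover have "AE w in Vw e \<beta>2. enn_powr (\<integral>\<^sup>+z. enn_powr (\<Phi> z w) q1 \<partial>Vw e \<beta>1) (q2 / q1) \<noteq> \<infinity>
        \<longrightarrow> (AE z in Vw e \<beta>1. \<Phi> z w \<noteq> \<infinity>)"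
    proof (rule AE_I2, rule impI)
      fix w assume w: "w \<in> space (Vw e \<beta>2)" and "enn_powr (\<integral>\<^sup>+z. enn_powr (\<Phi> z w) q1 \<partial>Vw e \<beta>1) (q2 / q1) \<noteq> \<infinity>"
      then have "(\<integral>\<^sup>+z. enn_powr (\<Phi> z w) q1 \<partial>Vw e \<beta>1) \<noteq> \<infinity>" by simp
      moreover have "(\<lambda>z. enn_powr (\<Phi> z w) q1) \<in> borel_measurable (Vw e \<beta>1)" using w by measurable
      ultimately have "AE z in Vw e \<beta>1. enn_powr (\<Phi> z w) q1 \<noteq> \<infinity>" by (intro nn_integral_noteq_infinite)
      then show "AE z in Vw e \<beta>1. \<Phi> z w \<noteq> \<infinity>" by simp
    qed
    ultimately have "AE w in Vw e \<beta>2. AE z in Vw e \<beta>1. \<Phi> z w \<noteq> \<infinity>"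
      by (rule AE_mp)
    then have "AE w in lborel. w \<in> TB e \<longrightarrow> (AE z in lborel. z \<in> TB e \<longrightarrow> \<Phi> z w \<noteq> \<infinity>)"
      by (simp only: AE_Vw)
    then have "AE w in lborel. AE z in lborel. (z \<in> TB e \<and> w \<in> TB e \<longrightarrow> \<Phi> z w \<noteq> \<infinity>)"
      by (rule eventually_mono) (auto elim: eventually_mono)
    \<comment> \<open>The mixed norm has w outermost, whereas passing to the product measure needs
      the first coordinate z outermost.\<close>
    then have "AE z in lborel. AE w in lborel. (z \<in> TB e \<and> w \<in> TB e \<longrightarrow> \<Phi> z w \<noteq> \<infinity>)"
      by (subst lborel_pair.AE_commute) measurable
    moreover have "Measurable.pred (lborel \<Otimes>\<^sub>M lborel) (\<lambda>x. fst x \<in> TB e \<and> snd x \<in> TB e \<longrightarrow> \<Phi> (fst x) (snd x) \<noteq> \<infinity>)"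
      unfolding infinity_ennreal_def less_top by measurable
    ultimately have "AE x in lborel \<Otimes>\<^sub>M lborel. (fst x \<in> TB e \<and> snd x \<in> TB e \<longrightarrow> \<Phi> (fst x) (snd x) \<noteq> \<infinity>)"
      by (intro lborel_pair.AE_pair_measure) (simp_all add: pred_def)
    then have "AE x in PP e. \<Phi> (fst x) (snd x) \<noteq> \<infinity>"
      unfolding PP_def using TB2_sets[of e]
      by (subst AE_restrict_space_iff) (auto simp: space_pair_measure elim!: eventually_mono)
    moreover have "AE x in PP e. \<Phi> (fst x) (snd x) \<noteq> \<infinity> \<longrightarrow> integrable (PP e) (\<lambda>y. K x y * f y)"
    proof (rule AE_I2, rule impI)
      fix x assume "x \<in> space (PP e)" and fin: "\<Phi> (fst x) (snd x) \<noteq> \<infinity>"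
      then obtain z w where x: "x = (z, w)" "z \<in> TB e" "w \<in> TB e" by auto
      have [measurable]: "K x \<in> borel_measurable (PP e)" using K_meas x by simp
      have pos: "rho e z powr a1 * rho e w powr a2 > 0" using x by (simp add: TB_def)
      have "(\<integral>\<^sup>+y. ennreal (cmod (K x y * f y)) \<partial>PP e) \<noteq> \<infinity>"
        using fin pos \<Phi>_eq[OF x(2,3)] by (auto simp: x(1) ennreal_mult_eq_top_iff ennreal_eq_0_iff)
      then show "integrable (PP e) (\<lambda>y. K x y * f y)"
        by (intro integrableI_bounded) (auto simp: less_top[symmetric])
    qed
    ultimately have "AE x in PP e. integrable (PP e) (\<lambda>y. K x y * f y)"
      by (rule AE_mp)
    with norm show ?thesis by simp
  qed
  show ?thesis
    unfolding bounded_op_def by (intro exI[of _ C] allI impI main)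
qed

subsection \<open>Kernels near a point of the imaginary axis\<close>

lemma rho_axis [simp]: "rho e (axis e (Complex 0 R)) = R"
proof -
  have "(\<Sum>i\<in>UNIV - {e}. (Im (axis e (Complex 0 R) $ i))\<^sup>2) = 0"
    by (intro sum.neutral) (auto simp: axis_def)
  then show ?thesis by (simp add: rho_def)
qed

lemma axis_in_TB [simp]: "axis e (Complex 0 R) \<in> TB e \<longleftrightarrow> 0 < R"
  by (simp add: TB_def)

text \<open>The difference in u does not involve z_n, as \<rho>(z,u) is affine in z_n, and it is at
  most linear in z'. Since D = 4 |\<rho>(z,u0)| dominates both |z'|^2 and 2R, this linear growth is
  absorbed by D, and \<delta> can be chosen independently of z.\<close>

lemma rho2_ratio_near_1:
  fixes e :: "'n::finite"
  assumes R: "R > 0" and \<epsilon>: "\<epsilon> > 0"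
  obtains \<delta> where "\<delta> > 0"
    "\<And>u z. dist u (axis e (Complex 0 R)) < \<delta> \<Longrightarrow> z \<in> TB e \<Longrightarrow>
       cmod (rho2 e z u / rho2 e z (axis e (Complex 0 R)) - 1) < \<epsilon>"
proof -
  let ?u0 = "axis e (Complex 0 R) :: complex^'n"
  let ?n = "real CARD('n)"
  \<comment> \<open>The difference is at most \<delta> (2 n D + 3 n + 2), and D >= 2R turns the
    constant part into a multiple of D; \<open>A\<close> is the resulting coefficient of \<delta>
    D.\<close>
  define A where "A = 2 * ?n + (3 * ?n + 2) / (2 * R)"
  have A: "A > 0" using R by (auto simp: A_def intro!: add_pos_pos)
  define \<delta> where "\<delta> = min 1 (\<epsilon> / (2 * A))"
  have \<delta>: "0 < \<delta>" "\<delta> \<le> 1" "\<delta> * A < \<epsilon>"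
  proof -
    show "0 < \<delta>" "\<delta> \<le> 1" using A \<epsilon> by (auto simp: \<delta>_def)
    have "\<delta> * A \<le> \<epsilon> / (2 * A) * A" using A by (intro mult_right_mono) (auto simp: \<delta>_def)
    also have "\<dots> < \<epsilon>" using A \<epsilon> by simp
    finally show "\<delta> * A < \<epsilon>" .
  qed
  show ?thesis
  proof (rule that[OF \<delta>(1)])
    fix u z :: "complex^'n"
    assume u: "dist u ?u0 < \<delta>" and z: "z \<in> TB e"
    define D where "D = cmod (4 * rho2 e z ?u0)"
    have Re: "Re (4 * rho2 e z ?u0) = 2 * rho e z + 2 * R + (\<Sum>i\<in>UNIV - {e}. (cmod (z $ i))\<^sup>2)"
      by (simp add: Re_rho2) (auto intro!: sum.cong simp: axis_def)
    have D: "2 * rho e z + 2 * R + (\<Sum>i\<in>UNIV - {e}. (cmod (z $ i))\<^sup>2) \<le> D"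
      using complex_Re_le_cmod[of "4 * rho2 e z ?u0"] unfolding Re D_def .
    have S: "0 \<le> (\<Sum>i\<in>UNIV - {e}. (cmod (z $ i))\<^sup>2)" by (intro sum_nonneg) auto
    have DR: "2 * R \<le> D" using D S z by (simp add: TB_def)
    have Dz: "cmod (z $ i) \<le> 1 + D" if "i \<noteq> e" for i
    proof -
      have "(cmod (z $ i))\<^sup>2 \<le> (\<Sum>i\<in>UNIV - {e}. (cmod (z $ i))\<^sup>2)"
        using that by (intro member_le_sum) auto
      moreover have "cmod (z $ i) \<le> 1 + (cmod (z $ i))\<^sup>2"
      proof -
        have "2 * cmod (z $ i) \<le> 1 + (cmod (z $ i))\<^sup>2"
          using zero_le_power2[of "cmod (z $ i) - 1"] by (simp add: power2_diff)
        then show ?thesis using norm_ge_zero[of "z $ i"] by linarith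
      qed
      ultimately show ?thesis using D R z by (simp add: TB_def)
    qed
    have comp: "cmod (u $ i - ?u0 $ i) \<le> \<delta>" for i
      using Finite_Cartesian_Product.norm_nth_le[of "u - ?u0" i] u by (simp add: dist_norm)
    have ui: "cmod (u $ i) \<le> \<delta>" if "i \<noteq> e" for i
      using comp[of i] that by (simp add: axis_def)
    have "4 * rho2 e z u - 4 * rho2 e z ?u0
        = (\<Sum>i\<in>UNIV - {e}. (z $ i - cnj (u $ i))\<^sup>2 - (z $ i)\<^sup>2) + 2 * \<i> * (cnj (u $ e) - cnj (?u0 $ e))"
    proof -
      have "(\<Sum>i\<in>UNIV - {e}. (z $ i - cnj (?u0 $ i))\<^sup>2) = (\<Sum>i\<in>UNIV - {e}. (z $ i)\<^sup>2)"
        by (intro sum.cong) (auto simp: axis_def)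
      then show ?thesis
        by (simp add: rho2_def sum_subtractf algebra_simps)
    qed
    then have "cmod (4 * rho2 e z u - 4 * rho2 e z ?u0)
        \<le> cmod (\<Sum>i\<in>UNIV - {e}. (z $ i - cnj (u $ i))\<^sup>2 - (z $ i)\<^sup>2) + cmod (2 * \<i> * (cnj (u $ e) - cnj (?u0 $ e)))"
      by (simp only: norm_triangle_ineq)
    also have "\<dots> \<le> (\<Sum>i\<in>UNIV - {e}. \<delta> * (2 * (1 + D) + 1)) + 2 * \<delta>"
    proof (intro add_mono order_trans[OF norm_sum sum_mono])
      fix i assume "i \<in> UNIV - {e}"
      then have i: "i \<noteq> e" by simp
      have "(z $ i - cnj (u $ i))\<^sup>2 - (z $ i)\<^sup>2 = cnj (u $ i) * (cnj (u $ i) - 2 * z $ i)"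
        by (simp add: power2_eq_square algebra_simps)
      then have "cmod ((z $ i - cnj (u $ i))\<^sup>2 - (z $ i)\<^sup>2) = cmod (u $ i) * cmod (cnj (u $ i) - 2 * z $ i)"
        by (simp add: norm_mult)
      also have "\<dots> \<le> \<delta> * (2 * (1 + D) + 1)"
      proof (intro mult_mono ui i)
        have "cmod (cnj (u $ i) - 2 * z $ i) \<le> cmod (u $ i) + 2 * cmod (z $ i)"
          using norm_triangle_ineq4[of "cnj (u $ i)" "2 * z $ i"] by (simp add: norm_mult)
        also have "\<dots> \<le> 1 + 2 * (1 + D)"
          using Dz[OF i] ui[OF i] \<delta>(2) by (intro add_mono mult_left_mono) auto
        finally show "cmod (cnj (u $ i) - 2 * z $ i) \<le> 2 * (1 + D) + 1"
          by (simp only: add.commute)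
      qed (use \<delta> in auto)
      finally show "cmod ((z $ i - cnj (u $ i))\<^sup>2 - (z $ i)\<^sup>2) \<le> \<delta> * (2 * (1 + D) + 1)" .
    next
      have "cmod (cnj (u $ e) - cnj (?u0 $ e)) = cmod (u $ e - ?u0 $ e)"
        by (metis complex_cnj_diff complex_mod_cnj)
      then show "cmod (2 * \<i> * (cnj (u $ e) - cnj (?u0 $ e))) \<le> 2 * \<delta>"
        using comp[of e] by (simp add: norm_mult)
    qed
    also have "\<dots> \<le> \<delta> * (?n * (2 * (1 + D) + 1) + 2)"
    proof -
      have "(\<Sum>i\<in>UNIV - {e}. \<delta> * (2 * (1 + D) + 1)) = real (card (UNIV - {e})) * (\<delta> * (2 * (1 + D) + 1))"
        by simp
      also have "\<dots> \<le> ?n * (\<delta> * (2 * (1 + D) + 1))"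
        using \<delta> DR R by (intro mult_right_mono) (auto intro!: card_mono)
      finally show ?thesis by (simp add: algebra_simps)
    qed
    also have "\<dots> \<le> \<delta> * (A * D)"
    proof (intro mult_left_mono)
      have "1 * (3 * ?n + 2) \<le> D / (2 * R) * (3 * ?n + 2)"
        using DR R by (intro mult_right_mono) auto
      moreover have "A * D = 2 * ?n * D + D / (2 * R) * (3 * ?n + 2)"
        using R by (simp add: A_def field_simps)
      ultimately show "?n * (2 * (1 + D) + 1) + 2 \<le> A * D"
        by (simp add: algebra_simps)
    qed (use \<delta> in auto)
    also have "\<dots> = \<delta> * A * D" by simp
    also have "\<dots> < \<epsilon> * D"
      using \<delta> DR R by (intro mult_strict_right_mono) auto
    finally have less: "cmod (4 * rho2 e z u - 4 * rho2 e z ?u0) < \<epsilon> * D" .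
    have "rho2 e z u / rho2 e z ?u0 - 1 = (4 * rho2 e z u - 4 * rho2 e z ?u0) / (4 * rho2 e z ?u0)"
      using rho2_nz[OF z, of ?u0] R by (simp add: field_simps)
    then have "cmod (rho2 e z u / rho2 e z ?u0 - 1) = cmod (4 * rho2 e z u - 4 * rho2 e z ?u0) / D"
      by (simp only: norm_divide D_def)
    also have "\<dots> < \<epsilon>" using less DR R by (simp add: divide_less_eq)
    finally show "cmod (rho2 e z u / rho2 e z ?u0 - 1) < \<epsilon>" .
  qed
qed

text \<open>The abstraction that covers both \<open>\<rho>(z,u)\<^sup>-\<^sup>c\<close> and \<open>|\<rho>(z,u)|\<^sup>-\<^sup>c\<close>.\<close>

locale inverse_power =
  fixes g :: "complex \<Rightarrow> complex" and c :: real
  assumes norm_eq: "0 < Re v \<Longrightarrow> cmod (g v) = cmod v powr - c"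
    and mult: "0 < Re v \<Longrightarrow> 0 < Re \<zeta> \<Longrightarrow> 0 < Re (v * \<zeta>) \<Longrightarrow> g (v * \<zeta>) = g v * g \<zeta>"
    and cont: "continuous_on {v. 0 < Re v} g"
begin

lemma one: "g 1 = 1"
proof -
  have "g 1 = g 1 * g 1" using mult[of 1 1] by simp
  moreover have "g 1 \<noteq> 0" using norm_eq[of 1] by auto
  ultimately show ?thesis by simp
qed

text \<open>The factor \<theta> is the relative error of the kernel; \<delta> may depend on R but
  not on z. The tolerance 1/5 is chosen so that the product of two such factors differs from 1 by at
  most 1/25 + 2/5 < 1/2.\<close>

lemma factor_near:
  fixes e :: "'n::finite"
  assumes R: "R > 0"
  obtains \<delta> where "\<delta> > 0"
    "\<And>u. dist u (axis e (Complex 0 R)) < \<delta> \<Longrightarrow> u \<in> TB e"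
    "\<And>u. dist u (axis e (Complex 0 R)) < \<delta> \<Longrightarrow> rho e u powr \<alpha> \<le> 2 * R powr \<alpha>"
    "\<And>u z. dist u (axis e (Complex 0 R)) < \<delta> \<Longrightarrow> z \<in> TB e \<Longrightarrow>
       \<exists>\<theta>. cmod (\<theta> - 1) \<le> 1/5 \<and> of_real (rho e u powr b) * g (rho2 e z u)
          = of_real (R powr b) * g (rho2 e z (axis e (Complex 0 R))) * \<theta>"
proof -
  let ?u0 = "axis e (Complex 0 R) :: complex^'n"
  have rho: "(rho e \<longlongrightarrow> R) (nhds ?u0)"
  proof -
    have "isCont (rho e) ?u0"
      using continuous_on_rho[OF continuous_on_id, of UNIV e] continuous_on_eq_continuous_at[of UNIV "rho e"] by auto
    then show ?thesis unfolding continuous_at tendsto_at_iff_tendsto_nhds by simp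
  qed
  have "((\<lambda>u. rho e u powr b / R powr b) \<longlongrightarrow> R powr b / R powr b) (nhds ?u0)"
    using rho R by (intro tendsto_intros) auto
  then have lim: "((\<lambda>u. of_real (rho e u powr b / R powr b)) \<longlongrightarrow> (1::complex)) (nhds ?u0)"
    using tendsto_of_real[of "\<lambda>u. rho e u powr b / R powr b" _ "nhds ?u0", where 'a = complex] R by fastforce
  have "isCont g 1"
    using cont by (rule continuous_on_interior)
      (simp add: interior_open open_halfspace_Re_gt)
  then have glim: "(g \<longlongrightarrow> 1) (nhds 1)"
    unfolding continuous_at tendsto_at_iff_tendsto_nhds by (simp add: one)
  have "((\<lambda>(x, y). x * g y) \<longlongrightarrow> 1 * 1) (nhds 1 \<times>\<^sub>F nhds 1)"
    unfolding case_prod_beta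
    by (intro tendsto_mult filterlim_compose[OF glim] filterlim_fst filterlim_snd)
  then have "eventually (\<lambda>p. dist (case p of (x, y) \<Rightarrow> x * g y) (1 * 1) < 1/5) (nhds 1 \<times>\<^sub>F nhds 1)"
    by (rule tendstoD) simp
  then obtain P Q where P: "eventually P (nhds 1)" and Q: "eventually Q (nhds 1)"
    and PQ: "\<And>x y. P x \<Longrightarrow> Q y \<Longrightarrow> dist (x * g y) 1 < 1/5"
    by (auto simp: eventually_prod_filter)
  have "eventually (\<lambda>u. P (of_real (rho e u powr b / R powr b))) (nhds ?u0)"
    using lim P by (auto simp: filterlim_iff)
  moreover have "eventually (\<lambda>u. 0 < rho e u) (nhds ?u0)"
    using order_tendstoD(1)[OF rho R] .
  moreover have "eventually (\<lambda>u. rho e u powr \<alpha> < 2 * R powr \<alpha>) (nhds ?u0)"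
    using tendsto_powr[OF rho tendsto_const[of \<alpha>]] R by (intro order_tendstoD(2)) auto
  ultimately have "eventually (\<lambda>u. P (of_real (rho e u powr b / R powr b)) \<and> 0 < rho e u \<and> rho e u powr \<alpha> < 2 * R powr \<alpha>) (nhds ?u0)"
    by eventually_elim auto
  then obtain d1 where d1: "d1 > 0" "\<And>u. dist u ?u0 < d1 \<Longrightarrow> P (of_real (rho e u powr b / R powr b)) \<and> 0 < rho e u \<and> rho e u powr \<alpha> < 2 * R powr \<alpha>"
    unfolding eventually_nhds_metric by auto
  obtain d2 where d2: "d2 > 0" "\<And>y. dist y 1 < d2 \<Longrightarrow> Q y"
    using Q unfolding eventually_nhds_metric by auto
  obtain d3 where d3: "d3 > 0" "\<And>u z. dist u ?u0 < d3 \<Longrightarrow> z \<in> TB e \<Longrightarrow> cmod (rho2 e z u / rho2 e z ?u0 - 1) < min 1 d2"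
    using rho2_ratio_near_1[OF R, of "min 1 d2" e] d2 by auto
  show ?thesis
  proof (rule that[of "min d1 d3"])
    fix u z :: "complex^'n" assume u: "dist u ?u0 < min d1 d3"
    then have near: "P (of_real (rho e u powr b / R powr b))" "0 < rho e u" "rho e u powr \<alpha> < 2 * R powr \<alpha>"
      using d1(2)[of u] by auto
    show uTB: "u \<in> TB e" using near by (simp add: TB_def)
    show "rho e u powr \<alpha> \<le> 2 * R powr \<alpha>" using near by simp
    assume z: "z \<in> TB e"
    \<comment> \<open>The ratio lies within distance 1 of 1, so its real part is positive and
      \<open>mult\<close> separates it from the value at the centre.\<close>
    define \<zeta> where "\<zeta> = rho2 e z u / rho2 e z ?u0"
    have \<zeta>: "cmod (\<zeta> - 1) < 1" "dist \<zeta> 1 < d2"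
      using d3(2)[OF _ z, of u] u by (auto simp: \<zeta>_def dist_norm)
    have "0 < Re \<zeta>" using \<zeta>(1) abs_Re_le_cmod[of "\<zeta> - 1"] by simp
    moreover have eq: "rho2 e z u = rho2 e z ?u0 * \<zeta>"
      using rho2_nz[OF z, of ?u0] R by (simp add: \<zeta>_def)
    ultimately have g: "g (rho2 e z u) = g (rho2 e z ?u0) * g \<zeta>"
      using Re_rho2_pos[OF z uTB] Re_rho2_pos[OF z, of ?u0] R unfolding eq by (intro mult) auto
    let ?\<theta> = "of_real (rho e u powr b / R powr b) * g \<zeta>"
    have "cmod (?\<theta> - 1) \<le> 1/5"
      using PQ[OF near(1), of \<zeta>] d2(2)[OF \<zeta>(2)] by (simp add: dist_norm)
    moreover have "of_real (rho e u powr b) * g (rho2 e z u) = of_real (R powr b) * g (rho2 e z ?u0) * ?\<theta>"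
      using R by (simp add: g)
    ultimately show "\<exists>\<theta>. cmod (\<theta> - 1) \<le> 1/5 \<and> of_real (rho e u powr b) * g (rho2 e z u)
          = of_real (R powr b) * g (rho2 e z ?u0) * \<theta>" by blast
  qed (use d1 d3 in auto)
qed

end

subsection \<open>Boundedness\<close>

definition tker :: "(complex \<Rightarrow> complex) \<Rightarrow> (complex \<Rightarrow> complex) \<Rightarrow> 'n::finite \<Rightarrow> real \<Rightarrow> real
    \<Rightarrow> (complex^'n) \<times> (complex^'n) \<Rightarrow> (complex^'n) \<times> (complex^'n) \<Rightarrow> complex" where
  "tker g1 g2 e b1 b2 x y = of_real (rho e (fst y) powr b1) * g1 (rho2 e (fst x) (fst y))
     * (of_real (rho e (snd y) powr b2) * g2 (rho2 e (snd x) (snd y)))"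

text \<open>The witness solves R^x = |C| + 1. It is large or small according to the sign of x, so
  one choice excludes both signs.\<close>

lemma powr_bounded_imp_exponent_0:
  fixes x C :: real
  assumes "\<And>R. R > 0 \<Longrightarrow> R powr x \<le> C"
  shows "x = 0"
proof (rule ccontr)
  assume "x \<noteq> 0"
  then have "((\<bar>C\<bar> + 1) powr (1 / x)) powr x = \<bar>C\<bar> + 1" by (simp add: powr_powr)
  moreover have "\<bar>C\<bar> + 1 \<noteq> 0" by linarith
  then have "0 < (\<bar>C\<bar> + 1) powr (1 / x)" by simp
  then have "((\<bar>C\<bar> + 1) powr (1 / x)) powr x \<le> C" by (rule assms)
  ultimately show False by linarith
qed

locale two_inverse_powers = g1: inverse_power g1 c1 + g2: inverse_power g2 c2 for g1 c1 g2 c2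
begin

lemma norm_tker:
  assumes "z \<in> TB e" "w \<in> TB e" "u \<in> TB e" "\<eta> \<in> TB e"
  shows "rho e z powr a1 * rho e w powr a2 * cmod (tker g1 g2 e b1 b2 (z, w) (u, \<eta>))
    = wker e a1 b1 c1 z u * wker e a2 b2 c2 w \<eta>"
  using assms by (simp add: tker_def wker_def norm_mult g1.norm_eq g2.norm_eq Re_rho2_pos powr_minus field_simps)

lemma measurable_tker:
  assumes x: "x \<in> TB e \<times> TB e"
  shows "tker g1 g2 e b1 b2 x \<in> borel_measurable (PP e)"
proof -
  have "continuous_on (TB e \<times> TB e) (tker g1 g2 e b1 b2 x)"
  proof -
    have *: "continuous_on (TB e \<times> TB e) (\<lambda>y. g1 (rho2 e (fst x) (fst y)))"
      using x by (intro continuous_on_compose2[OF g1.cont] continuous_intros) (auto intro: Re_rho2_pos)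
    have **: "continuous_on (TB e \<times> TB e) (\<lambda>y. g2 (rho2 e (snd x) (snd y)))"
      using x by (intro continuous_on_compose2[OF g2.cont] continuous_intros) (auto intro: Re_rho2_pos)
    show ?thesis
      unfolding tker_def[abs_def]
      by (intro continuous_intros * **) (auto simp: TB_def)
  qed
  then have "tker g1 g2 e b1 b2 x \<in> borel_measurable (restrict_space borel (TB e \<times> TB e))"
    by (rule borel_measurable_continuous_on_restrict)
  moreover have "sets (PP e) = sets (restrict_space borel (TB e \<times> TB e))"
    by (simp add: PP_def lborel_prod sets_restrict_space)
  ultimately show ?thesis
    using measurable_cong_sets by blast
qed

text \<open>The left side is the mixed norm of the kernel column at the two centres. The test
  function is the indicator of a product of balls of volume V: its norm is at most 4 V R1^\<alpha>1
  R2^\<alpha>2, as each weight at most doubles, and its image is at least V/2 times the column. V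
  cancels, leaving 8 C.\<close>

lemma norm_le_if_bounded_op:
  fixes e :: "'n::finite"
  assumes q: "1 \<le> q1" "1 \<le> q2"
    and bdd: "bounded_op e a1 a2 (tker g1 g2 e b1 b2) 1 1 \<alpha>1 \<alpha>2 q1 q2 \<beta>1 \<beta>2"
  obtains C :: real where "\<And>R1 R2. R1 > 0 \<Longrightarrow> R2 > 0 \<Longrightarrow>
    enn_powr (\<integral>\<^sup>+z. ennreal (wker e a1 b1 c1 z (axis e (Complex 0 R1)) powr q1) \<partial>Vw e \<beta>1) (1 / q1)
    * enn_powr (\<integral>\<^sup>+w. ennreal (wker e a2 b2 c2 w (axis e (Complex 0 R2)) powr q2) \<partial>Vw e \<beta>2) (1 / q2)
    \<le> ennreal (C * R1 powr \<alpha>1 * R2 powr \<alpha>2)"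
proof -
  let ?K = "tker g1 g2 e b1 b2"
  obtain C0 where "\<And>f. inL e 1 1 \<alpha>1 \<alpha>2 f \<Longrightarrow>
        mnorm e q1 q2 \<beta>1 \<beta>2 (intop e a1 a2 ?K f) \<le> ennreal C0 * mnorm e 1 1 \<alpha>1 \<alpha>2 f"
    using bdd by (auto simp: bounded_op_def)
  \<comment> \<open>A negative constant acts as 0 through \<open>ennreal\<close>, so C may be taken
    nonnegative.\<close>
  then obtain C where C: "C \<ge> 0" "\<And>f. inL e 1 1 \<alpha>1 \<alpha>2 f \<Longrightarrow>
        mnorm e q1 q2 \<beta>1 \<beta>2 (intop e a1 a2 ?K f) \<le> ennreal C * mnorm e 1 1 \<alpha>1 \<alpha>2 f"
    by (metis ennreal_neg le_cases mult_zero_left order_refl)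
  show ?thesis
  proof (rule that[of "8 * C"])
    fix R1 R2 :: real assume R: "R1 > 0" "R2 > 0"
    let ?u0 = "axis e (Complex 0 R1) :: complex^'n" and ?\<eta>0 = "axis e (Complex 0 R2) :: complex^'n"
    obtain d1 where d1: "d1 > 0"
      "\<And>u. dist u ?u0 < d1 \<Longrightarrow> u \<in> TB e"
      "\<And>u. dist u ?u0 < d1 \<Longrightarrow> rho e u powr \<alpha>1 \<le> 2 * R1 powr \<alpha>1"
      "\<And>u z. dist u ?u0 < d1 \<Longrightarrow> z \<in> TB e \<Longrightarrow>
         \<exists>\<theta>. cmod (\<theta> - 1) \<le> 1/5 \<and> of_real (rho e u powr b1) * g1 (rho2 e z u) = of_real (R1 powr b1) * g1 (rho2 e z ?u0) * \<theta>"
      using g1.factor_near[OF R(1), of e \<alpha>1 b1] by blast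
    obtain d2 where d2: "d2 > 0"
      "\<And>u. dist u ?\<eta>0 < d2 \<Longrightarrow> u \<in> TB e"
      "\<And>u. dist u ?\<eta>0 < d2 \<Longrightarrow> rho e u powr \<alpha>2 \<le> 2 * R2 powr \<alpha>2"
      "\<And>u z. dist u ?\<eta>0 < d2 \<Longrightarrow> z \<in> TB e \<Longrightarrow>
         \<exists>\<theta>. cmod (\<theta> - 1) \<le> 1/5 \<and> of_real (rho e u powr b2) * g2 (rho2 e z u) = of_real (R2 powr b2) * g2 (rho2 e z ?\<eta>0) * \<theta>"
      using g2.factor_near[OF R(2), of e \<alpha>2 b2] by blast
    define B where "B = ball ?u0 d1 \<times> ball ?\<eta>0 d2"
    have B_TB: "B \<subseteq> TB e \<times> TB e"
      using d1(2) d2(2) by (auto simp: B_def dist_commute)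
    then have B_Int[simp]: "B \<inter> TB e \<times> TB e = B" by blast
    have B_sets: "B \<in> sets (lborel \<Otimes>\<^sub>M lborel)" unfolding B_def by (intro pair_measureI) auto
    have B_PP[measurable]: "B \<in> sets (PP e)"
      unfolding PP_def using B_TB B_sets TB2_sets[of e] by (subst sets_restrict_space_iff) auto
    have em: "emeasure (PP e) B = emeasure lborel (ball ?u0 d1) * emeasure lborel (ball ?\<eta>0 d2)"
    proof -
      have "emeasure (PP e) B = emeasure (lborel \<Otimes>\<^sub>M lborel) B"
        unfolding PP_def using B_TB TB2_sets[of e] by (intro emeasure_restrict_space) (auto simp: space_pair_measure)
      also have "\<dots> = emeasure lborel (ball ?u0 d1) * emeasure lborel (ball ?\<eta>0 d2)"
        unfolding B_def by (intro lborel.emeasure_pair_measure_Times) auto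
      finally show ?thesis .
    qed
    define V where "V = measure (PP e) B"
    have V_eq: "emeasure (PP e) B = ennreal V"
      unfolding V_def using em emeasure_lborel_ball_finite[of ?u0 d1] emeasure_lborel_ball_finite[of ?\<eta>0 d2]
      by (intro emeasure_eq_ennreal_measure) (auto simp: ennreal_mult_eq_top_iff less_top[symmetric])
    have "V = measure lborel (ball ?u0 d1) * measure lborel (ball ?\<eta>0 d2)"
      by (simp add: V_def measure_def em enn2real_mult)
    then have V: "V > 0"
      using d1(1) d2(1) by (simp add: content_ball_pos)
    define f :: "(complex^'n) \<times> (complex^'n) \<Rightarrow> complex" where "f = indicator B"
    have [measurable]: "f \<in> borel_measurable (PP e)" by (simp add: f_def)
    have f_norm: "mnorm e 1 1 \<alpha>1 \<alpha>2 f \<le> ennreal (4 * R1 powr \<alpha>1 * R2 powr \<alpha>2 * V)"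
    proof -
      have "mnorm e 1 1 \<alpha>1 \<alpha>2 f = (\<integral>\<^sup>+y. ennreal (cmod (f y) * rho e (fst y) powr \<alpha>1 * rho e (snd y) powr \<alpha>2) \<partial>PP e)"
        by (rule mnorm_1_1) measurable
      also have "\<dots> \<le> (\<integral>\<^sup>+y. ennreal (4 * R1 powr \<alpha>1 * R2 powr \<alpha>2) * indicator B y \<partial>PP e)"
      proof (intro nn_integral_mono)
        fix y :: "(complex^'n) \<times> (complex^'n)"
        show "ennreal (cmod (f y) * rho e (fst y) powr \<alpha>1 * rho e (snd y) powr \<alpha>2) \<le> ennreal (4 * R1 powr \<alpha>1 * R2 powr \<alpha>2) * indicator B y"
        proof (cases "y \<in> B")
          case True
          then have "rho e (fst y) powr \<alpha>1 \<le> 2 * R1 powr \<alpha>1" "rho e (snd y) powr \<alpha>2 \<le> 2 * R2 powr \<alpha>2"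
            using d1(3) d2(3) by (auto simp: B_def dist_commute)
          then have "rho e (fst y) powr \<alpha>1 * rho e (snd y) powr \<alpha>2 \<le> (2 * R1 powr \<alpha>1) * (2 * R2 powr \<alpha>2)"
            by (intro mult_mono) auto
          then show ?thesis using True by (simp add: f_def mult_ac)
        qed (simp add: f_def)
      qed
      also have "\<dots> = ennreal (4 * R1 powr \<alpha>1 * R2 powr \<alpha>2 * V)"
        using V by (simp add: nn_integral_cmult_indicator V_eq ennreal_mult)
      finally show ?thesis .
    qed
    then have "inL e 1 1 \<alpha>1 \<alpha>2 f"
      using le_less_trans[OF f_norm ennreal_less_top] by (simp add: inL_def)
    then have "mnorm e q1 q2 \<beta>1 \<beta>2 (intop e a1 a2 ?K f) \<le> ennreal C * mnorm e 1 1 \<alpha>1 \<alpha>2 f" by (rule C(2))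
    also have "\<dots> \<le> ennreal C * ennreal (4 * R1 powr \<alpha>1 * R2 powr \<alpha>2 * V)"
      by (intro mult_left_mono f_norm) simp
    finally have upper: "mnorm e q1 q2 \<beta>1 \<beta>2 (intop e a1 a2 ?K f) \<le> ennreal C * ennreal (4 * R1 powr \<alpha>1 * R2 powr \<alpha>2 * V)" .
    let ?k1 = "\<lambda>z. wker e a1 b1 c1 z ?u0" and ?k2 = "\<lambda>w. wker e a2 b2 c2 w ?\<eta>0"
    \<comment> \<open>The integral is K0 times V plus an error of modulus at most V/2, so
      oscillation cancels at most half of the mass. Dividing by \<open>K0\<close> makes the estimate
      uniform in (z,w), however small \<open>K0\<close> is.\<close>
    have lower: "V / 2 * (?k1 z * ?k2 w) \<le> cmod (intop e a1 a2 ?K f (z, w))" if z: "z \<in> TB e" and w: "w \<in> TB e" for z w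
    proof -
      define K0 where "K0 = ?K (z, w) (?u0, ?\<eta>0)"
      have K0: "rho e z powr a1 * rho e w powr a2 * cmod K0 = ?k1 z * ?k2 w"
        unfolding K0_def using norm_tker[OF z w, of ?u0 ?\<eta>0] R by simp
      then have "K0 \<noteq> 0" using wker_pos[OF z, of ?u0 a1 b1 c1] wker_pos[OF w, of ?\<eta>0 a2 b2 c2] R by auto
      define \<Theta> where "\<Theta> y = ?K (z, w) y / K0" for y
      have [measurable]: "\<Theta> \<in> borel_measurable (PP e)"
        unfolding \<Theta>_def[abs_def] using measurable_tker[of "(z, w)" e b1 b2] z w by simp
      have \<Theta>: "cmod (\<Theta> y - 1) \<le> 1/2" if y: "y \<in> B" for y
      proof -
        obtain \<theta>1 where t1: "cmod (\<theta>1 - 1) \<le> 1/5" "of_real (rho e (fst y) powr b1) * g1 (rho2 e z (fst y)) = of_real (R1 powr b1) * g1 (rho2 e z ?u0) * \<theta>1"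
          using d1(4)[OF _ z, of "fst y"] y by (auto simp: B_def dist_commute)
        obtain \<theta>2 where t2: "cmod (\<theta>2 - 1) \<le> 1/5" "of_real (rho e (snd y) powr b2) * g2 (rho2 e w (snd y)) = of_real (R2 powr b2) * g2 (rho2 e w ?\<eta>0) * \<theta>2"
          using d2(4)[OF _ w, of "snd y"] y by (auto simp: B_def dist_commute)
        have "?K (z, w) y = K0 * (\<theta>1 * \<theta>2)"
          unfolding K0_def tker_def fst_conv snd_conv t1(2) t2(2) by simp
        then have "\<Theta> y = \<theta>1 * \<theta>2" using \<open>K0 \<noteq> 0\<close> by (simp add: \<Theta>_def)
        \<comment> \<open>Writes the error of a product through the two separate errors, each at
          most 1/5.\<close>
        then have "\<Theta> y - 1 = (\<theta>1 - 1) * (\<theta>2 - 1) + (\<theta>1 - 1) + (\<theta>2 - 1)" by (simp add: algebra_simps)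
        then have "cmod (\<Theta> y - 1) \<le> cmod (\<theta>1 - 1) * cmod (\<theta>2 - 1) + cmod (\<theta>1 - 1) + cmod (\<theta>2 - 1)"
          by (simp only:) (intro order_trans[OF norm_triangle_ineq] add_mono, auto simp: norm_mult)
        also have "\<dots> \<le> 1/5 * (1/5) + 1/5 + 1/5"
          using t1 t2 by (intro add_mono mult_mono) auto
        finally show ?thesis by simp
      qed
      have ind: "integrable (PP e) (\<lambda>y. indicator B y *\<^sub>R (h y :: complex))"
        if [measurable]: "h \<in> borel_measurable (PP e)" and "\<And>y. y \<in> B \<Longrightarrow> cmod (h y) \<le> M" for h M
        using that V_eq
        by (intro integrableI_bounded_set_indicator[where B = M]) auto
      have int1: "integrable (PP e) (\<lambda>y. indicator B y *\<^sub>R (1::complex))"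
        by (rule ind[where M = 1]) auto
      have int2: "integrable (PP e) (\<lambda>y. indicator B y *\<^sub>R (\<Theta> y - 1))"
        by (rule ind[where M = "1/2", OF _ \<Theta>]) measurable
      have int3: "integrable (PP e) (\<lambda>y. indicator B y *\<^sub>R (1/2::real))"
        using V_eq B_PP by (intro integrable_scaleR_left integrable_real_indicator) (auto simp: less_top)
      have "integral\<^sup>L (PP e) (\<lambda>y. ?K (z, w) y * f y) = (\<integral>y. K0 * (indicator B y *\<^sub>R 1 + indicator B y *\<^sub>R (\<Theta> y - 1)) \<partial>PP e)"
        using \<open>K0 \<noteq> 0\<close> by (intro Bochner_Integration.integral_cong) (auto simp: f_def \<Theta>_def indicator_def)
      also have "\<dots> = K0 * (of_real V + (\<integral>y. indicator B y *\<^sub>R (\<Theta> y - 1) \<partial>PP e))"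
        using int1 int2 B_PP V_eq by (simp add: V_def scaleR_conv_of_real)
      finally have I: "integral\<^sup>L (PP e) (\<lambda>y. ?K (z, w) y * f y) = K0 * (of_real V + (\<integral>y. indicator B y *\<^sub>R (\<Theta> y - 1) \<partial>PP e))" .
      have "cmod (\<integral>y. indicator B y *\<^sub>R (\<Theta> y - 1) \<partial>PP e) \<le> (\<integral>y. cmod (indicator B y *\<^sub>R (\<Theta> y - 1)) \<partial>PP e)"
        by (rule integral_norm_bound)
      also have "\<dots> \<le> (\<integral>y. indicator B y *\<^sub>R (1/2) \<partial>PP e)"
        using \<Theta> by (intro integral_mono integrable_norm[OF int2] int3) (auto simp: indicator_def)
      also have "\<dots> = V / 2" using B_PP V_eq by (simp add: V_def)
      finally have small: "cmod (\<integral>y. indicator B y *\<^sub>R (\<Theta> y - 1) \<partial>PP e) \<le> V / 2" .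
      have "V / 2 \<le> cmod (of_real V + (\<integral>y. indicator B y *\<^sub>R (\<Theta> y - 1) \<partial>PP e))"
        using norm_diff_ineq[of "of_real V :: complex" "\<integral>y. indicator B y *\<^sub>R (\<Theta> y - 1) \<partial>PP e"] small V by simp
      then have "rho e z powr a1 * rho e w powr a2 * cmod K0 * (V / 2)
          \<le> rho e z powr a1 * rho e w powr a2 * cmod K0 * cmod (of_real V + (\<integral>y. indicator B y *\<^sub>R (\<Theta> y - 1) \<partial>PP e))"
        by (intro mult_left_mono) auto
      moreover have "cmod (intop e a1 a2 ?K f (z, w))
          = rho e z powr a1 * rho e w powr a2 * cmod K0 * cmod (of_real V + (\<integral>y. indicator B y *\<^sub>R (\<Theta> y - 1) \<partial>PP e))"
        unfolding intop_def prod.case I by (simp add: norm_mult)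
      ultimately show ?thesis
        unfolding K0[symmetric] by (simp only: mult.commute)
    qed
    let ?J1 = "\<integral>\<^sup>+z. ennreal (?k1 z powr q1) \<partial>Vw e \<beta>1" and ?J2 = "\<integral>\<^sup>+w. ennreal (?k2 w powr q2) \<partial>Vw e \<beta>2"
    \<comment> \<open>The mixed norm of a tensor product factors: the inner integral releases a
      q1-th power of the w-factor, and the exponent q2/q1 makes it a q2-th power.\<close>
    have "ennreal (V / 2) * (enn_powr ?J1 (1 / q1) * enn_powr ?J2 (1 / q2))
        = enn_powr (\<integral>\<^sup>+w. enn_powr (\<integral>\<^sup>+z. ennreal ((V / 2 * (?k1 z * ?k2 w)) powr q1) \<partial>Vw e \<beta>1) (q2 / q1) \<partial>Vw e \<beta>2) (1 / q2)"
    proof -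
      have inner: "(\<integral>\<^sup>+z. ennreal ((V / 2 * (?k1 z * ?k2 w)) powr q1) \<partial>Vw e \<beta>1)
          = ennreal ((V / 2 * ?k2 w) powr q1) * ?J1" for w
      proof -
        have "(\<integral>\<^sup>+z. ennreal ((V / 2 * (?k1 z * ?k2 w)) powr q1) \<partial>Vw e \<beta>1)
            = (\<integral>\<^sup>+z. ennreal ((V / 2 * ?k2 w) powr q1) * ennreal (?k1 z powr q1) \<partial>Vw e \<beta>1)"
        proof (intro nn_integral_cong)
          fix z
          have "(V / 2 * (?k1 z * ?k2 w)) powr q1 = (V / 2 * ?k2 w) powr q1 * ?k1 z powr q1"
            using V by (subst powr_mult[symmetric]) (auto simp: mult_ac)
          then show "ennreal ((V / 2 * (?k1 z * ?k2 w)) powr q1) = ennreal ((V / 2 * ?k2 w) powr q1) * ennreal (?k1 z powr q1)"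
            by (simp only: ennreal_mult powr_ge_zero)
        qed
        also have "\<dots> = ennreal ((V / 2 * ?k2 w) powr q1) * ?J1"
          by (intro nn_integral_cmult measurable_Vw) measurable
        finally show ?thesis .
      qed
      have "enn_powr (ennreal ((V / 2 * ?k2 w) powr q1) * ?J1) (q2 / q1)
          = enn_powr ?J1 (q2 / q1) * ennreal ((V / 2) powr q2) * ennreal (?k2 w powr q2)" for w
      proof -
        have "(V / 2 * ?k2 w) powr q2 = (V / 2) powr q2 * ?k2 w powr q2"
          using V by (subst powr_mult) auto
        then have "ennreal ((V / 2 * ?k2 w) powr q2) = ennreal ((V / 2) powr q2) * ennreal (?k2 w powr q2)"
          by (simp only: ennreal_mult powr_ge_zero)
        then show ?thesis
          using q V by (simp add: enn_powr_mult enn_powr_ennreal powr_powr mult_ac)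
      qed
      then have "(\<integral>\<^sup>+w. enn_powr (ennreal ((V / 2 * ?k2 w) powr q1) * ?J1) (q2 / q1) \<partial>Vw e \<beta>2)
          = (\<integral>\<^sup>+w. enn_powr ?J1 (q2 / q1) * ennreal ((V / 2) powr q2) * ennreal (?k2 w powr q2) \<partial>Vw e \<beta>2)"
        by simp
      also have "\<dots> = enn_powr ?J1 (q2 / q1) * ennreal ((V / 2) powr q2) * ?J2"
        by (intro nn_integral_cmult measurable_Vw) measurable
      finally show ?thesis
        unfolding inner using q V
        by (simp add: enn_powr_mult enn_powr_powr enn_powr_ennreal powr_powr mult_ac)
    qed
    also have "\<dots> \<le> mnorm e q1 q2 \<beta>1 \<beta>2 (intop e a1 a2 ?K f)"
      unfolding mnorm_def using q V lower
      by (intro enn_powr_mono nn_integral_mono ennreal_leI powr_mono2) auto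
    also note upper
    also have "ennreal C * ennreal (4 * R1 powr \<alpha>1 * R2 powr \<alpha>2 * V) = ennreal (V / 2) * ennreal (8 * C * R1 powr \<alpha>1 * R2 powr \<alpha>2)"
      using C V by (simp add: mult_ac flip: ennreal_mult)
    finally show "enn_powr ?J1 (1 / q1) * enn_powr ?J2 (1 / q2) \<le> ennreal (8 * C * R1 powr \<alpha>1 * R2 powr \<alpha>2)"
      using V by (subst (asm) ennreal_mult_le_mult_iff) (auto simp: ennreal_eq_0_iff)
  qed
qed

text \<open>Multiplied by q, the formula for c is the vanishing of the homogeneity degree. Under
  this equation c q - (n + 1 + a q + \<beta>) = (b - \<alpha>) q, so finiteness of the Forelli-Rudin
  constant becomes the two strict inequalities.\<close>

lemma bounded_op_iff:
  fixes e :: "'n::finite"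
  assumes q: "1 \<le> q1" "1 \<le> q2"
  shows "bounded_op e a1 a2 (tker g1 g2 e b1 b2) 1 1 \<alpha>1 \<alpha>2 q1 q2 \<beta>1 \<beta>2 \<longleftrightarrow>
    - q1 * a1 < \<beta>1 + 1 \<and> \<alpha>1 < b1 \<and>
    c1 = real CARD('n) + 1 + a1 + b1 + ((real CARD('n) + 1 + \<beta>1) / q1 - (real CARD('n) + 1 + \<alpha>1)) \<and>
    - q2 * a2 < \<beta>2 + 1 \<and> \<alpha>2 < b2 \<and>
    c2 = real CARD('n) + 1 + a2 + b2 + ((real CARD('n) + 1 + \<beta>2) / q2 - (real CARD('n) + 1 + \<alpha>2))"
    (is "?L \<longleftrightarrow> ?R")
proof -
  let ?n = "real CARD('n)"
  define F1 where "F1 = FR_const e (a1 * q1 + \<beta>1) (c1 * q1)"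
  define F2 where "F2 = FR_const e (a2 * q2 + \<beta>2) (c2 * q2)"
  have cond: "(- q * a < \<beta> + 1 \<and> \<alpha> < b \<and> c = ?n + 1 + a + b + ((?n + 1 + \<beta>) / q - (?n + 1 + \<alpha>))) \<longleftrightarrow>
      FR_const e (a * q + \<beta>) (c * q) \<noteq> \<infinity> \<and> (b - \<alpha>) * q + (?n + 1 + (a * q + \<beta>) - c * q) = 0"
    if q: "1 \<le> q" for q a \<beta> \<alpha> b c
  proof -
    have c: "c = ?n + 1 + a + b + ((?n + 1 + \<beta>) / q - (?n + 1 + \<alpha>)) \<longleftrightarrow>
        (b - \<alpha>) * q + (?n + 1 + (a * q + \<beta>) - c * q) = 0"
      using q by (auto simp: field_simps)
    have "FR_const e (a * q + \<beta>) (c * q) \<noteq> \<infinity> \<longleftrightarrow> a * q + \<beta> > -1 \<and> c * q > ?n + 1 + (a * q + \<beta>)"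
      using FR_const_finite[of "a * q + \<beta>" "c * q" e] FR_const_finiteD[of e "a * q + \<beta>" "c * q"] by force
    moreover have "c * q > ?n + 1 + (a * q + \<beta>) \<longleftrightarrow> \<alpha> < b" if "(b - \<alpha>) * q + (?n + 1 + (a * q + \<beta>) - c * q) = 0"
    proof -
      have "c * q - (?n + 1 + (a * q + \<beta>)) = (b - \<alpha>) * q" using that by linarith
      then have "c * q > ?n + 1 + (a * q + \<beta>) \<longleftrightarrow> 0 < (b - \<alpha>) * q" by linarith
      also have "\<dots> \<longleftrightarrow> \<alpha> < b" using q by (simp add: zero_less_mult_iff)
      finally show ?thesis .
    qed
    moreover have "- q * a < \<beta> + 1 \<longleftrightarrow> a * q + \<beta> > -1" by (auto simp: mult.commute)
    ultimately show ?thesis unfolding c by blast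
  qed
  \<comment> \<open>The column norm is homogeneous of degree x1 + \<alpha>1 in R1, so
    \<open>x1\<close> is the degree that remains after dividing by R1^\<alpha>1; likewise for
    \<open>x2\<close>.\<close>
  define x1 where "x1 = (b1 * q1 + (?n + 1 + (a1 * q1 + \<beta>1) - c1 * q1)) / q1 - \<alpha>1"
  define x2 where "x2 = (b2 * q2 + (?n + 1 + (a2 * q2 + \<beta>2) - c2 * q2)) / q2 - \<alpha>2"
  have x: "(b1 - \<alpha>1) * q1 + (?n + 1 + (a1 * q1 + \<beta>1) - c1 * q1) = 0 \<longleftrightarrow> x1 = 0"
      "(b2 - \<alpha>2) * q2 + (?n + 1 + (a2 * q2 + \<beta>2) - c2 * q2) = 0 \<longleftrightarrow> x2 = 0"
    using q by (auto simp: x1_def x2_def field_simps)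
  have R: "?R \<longleftrightarrow> (F1 \<noteq> \<infinity> \<and> x1 = 0) \<and> (F2 \<noteq> \<infinity> \<and> x2 = 0)"
    using cond[OF q(1), of a1 \<beta>1 \<alpha>1 b1 c1] cond[OF q(2), of a2 \<beta>2 \<alpha>2 b2 c2] unfolding x F1_def F2_def by blast
  show ?thesis
    unfolding R
  proof
    assume ?L
    then obtain C where "\<And>R1 R2. R1 > 0 \<Longrightarrow> R2 > 0 \<Longrightarrow>
      enn_powr (\<integral>\<^sup>+z. ennreal (wker e a1 b1 c1 z (axis e (Complex 0 R1)) powr q1) \<partial>Vw e \<beta>1) (1 / q1)
      * enn_powr (\<integral>\<^sup>+w. ennreal (wker e a2 b2 c2 w (axis e (Complex 0 R2)) powr q2) \<partial>Vw e \<beta>2) (1 / q2)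
      \<le> ennreal (C * R1 powr \<alpha>1 * R2 powr \<alpha>2)"
      using norm_le_if_bounded_op[OF q] by blast
    then have le: "ennreal (R1 powr (x1 + \<alpha>1)) * enn_powr F1 (1 / q1) * (ennreal (R2 powr (x2 + \<alpha>2)) * enn_powr F2 (1 / q2))
        \<le> ennreal (C * R1 powr \<alpha>1 * R2 powr \<alpha>2)" if "R1 > 0" "R2 > 0" for R1 R2
      using that q unfolding x1_def x2_def F1_def F2_def
      by (simp add: nn_integral_wker enn_powr_mult enn_powr_ennreal powr_powr)
    have F0: "F1 \<noteq> 0" "F2 \<noteq> 0" by (simp_all add: F1_def F2_def FR_const_pos)
    \<comment> \<open>At R1 = R2 = 1 the product of both constants is bounded. Since neither is 0,
      neither can be infinite.\<close>
    have fin: "F1 \<noteq> \<infinity>" "F2 \<noteq> \<infinity>"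
      using le[of 1 1] F0 by (auto simp: ennreal_top_mult ennreal_mult_top top_unique)
    define m where "m = enn2real (enn_powr F1 (1 / q1) * enn_powr F2 (1 / q2))"
    have m_eq: "enn_powr F1 (1 / q1) * enn_powr F2 (1 / q2) = ennreal m"
      unfolding m_def using fin by (subst ennreal_enn2real) (auto simp: less_top[symmetric] ennreal_mult_eq_top_iff)
    have "m \<ge> 0" by (simp add: m_def)
    moreover have "m \<noteq> 0" using m_eq F0 by (metis enn_powr_eq_0_iff ennreal_0 mult_eq_0_iff)
    ultimately have m: "m > 0" by simp
    have bdd: "R1 powr x1 * R2 powr x2 \<le> \<bar>C\<bar> / m" if R: "R1 > 0" "R2 > 0" for R1 R2
    proof -
      have "ennreal (R1 powr (x1 + \<alpha>1) * R2 powr (x2 + \<alpha>2) * m)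
          = ennreal (R1 powr (x1 + \<alpha>1)) * enn_powr F1 (1 / q1) * (ennreal (R2 powr (x2 + \<alpha>2)) * enn_powr F2 (1 / q2))"
        using m by (simp add: ennreal_mult m_eq[symmetric] mult_ac)
      also have "\<dots> \<le> ennreal (C * R1 powr \<alpha>1 * R2 powr \<alpha>2)" by (rule le[OF R])
      also have "\<dots> \<le> ennreal (\<bar>C\<bar> * R1 powr \<alpha>1 * R2 powr \<alpha>2)"
        by (intro ennreal_leI mult_right_mono) auto
      finally have "R1 powr (x1 + \<alpha>1) * R2 powr (x2 + \<alpha>2) * m \<le> \<bar>C\<bar> * R1 powr \<alpha>1 * R2 powr \<alpha>2"
        by (subst (asm) ennreal_le_iff) auto
      then have "(R1 powr x1 * R2 powr x2 * m) * (R1 powr \<alpha>1 * R2 powr \<alpha>2) \<le> \<bar>C\<bar> * (R1 powr \<alpha>1 * R2 powr \<alpha>2)"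
        by (simp add: powr_add mult_ac)
      then have "R1 powr x1 * R2 powr x2 * m \<le> \<bar>C\<bar>"
        using R by (subst (asm) mult_le_cancel_right) (auto simp: zero_less_mult_iff)
      then show ?thesis using m by (simp add: pos_le_divide_eq)
    qed
    \<comment> \<open>Setting R2 = 1 isolates the power of R1; the other exponent is treated
      symmetrically.\<close>
    have "x1 = 0" using bdd[of _ 1] by (intro powr_bounded_imp_exponent_0[of x1 "\<bar>C\<bar> / m"]) simp
    moreover have "x2 = 0" using bdd[of 1] by (intro powr_bounded_imp_exponent_0[of x2 "\<bar>C\<bar> / m"]) simp
    ultimately show "(F1 \<noteq> \<infinity> \<and> x1 = 0) \<and> (F2 \<noteq> \<infinity> \<and> x2 = 0)" using fin by simp
  next
    assume A: "(F1 \<noteq> \<infinity> \<and> x1 = 0) \<and> (F2 \<noteq> \<infinity> \<and> x2 = 0)"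
    show ?L
    proof (rule bounded_op_if_FR_const_finite[OF q])
      show "rho e z powr a1 * rho e w powr a2 * cmod (tker g1 g2 e b1 b2 (z, w) (u, \<eta>)) = wker e a1 b1 c1 z u * wker e a2 b2 c2 w \<eta>"
        if "z \<in> TB e" "w \<in> TB e" "u \<in> TB e" "\<eta> \<in> TB e" for z w u \<eta>
        using that by (rule norm_tker)
    qed (use A x in \<open>auto simp: F1_def F2_def intro: measurable_tker\<close>)
  qed
qed

end

section \<open>The two kernels as instances of the abstract inverse power\<close>

lemma Ln_mult_Re_pos:
  assumes "0 < Re v" "0 < Re \<zeta>"
  shows "Ln (v * \<zeta>) = Ln v + Ln \<zeta>"
proof -
  have "v \<noteq> 0" "\<zeta> \<noteq> 0" using assms by auto
  \<comment> \<open>Both arguments lie in (-pi/2, pi/2), so their sum stays off the branch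
    cut.\<close>
  moreover have "\<bar>Im (Ln v)\<bar> < pi / 2" "\<bar>Im (Ln \<zeta>)\<bar> < pi / 2"
    using assms Re_Ln_pos_lt[OF \<open>v \<noteq> 0\<close>] Re_Ln_pos_lt[OF \<open>\<zeta> \<noteq> 0\<close>] by blast+
  ultimately show ?thesis by (intro Ln_times_simple) (auto simp: abs_less_iff)
qed

lemma inverse_power_powr: "inverse_power (\<lambda>v. v powr - of_real c) c"
proof
  show "cmod (v powr - of_real c) = cmod v powr - c" if "0 < Re v" for v
    using norm_powr_real_powr'[of "- of_real c" v] by simp
  show "(v * \<zeta>) powr - of_real c = v powr - of_real c * \<zeta> powr - of_real c"
    if "0 < Re v" "0 < Re \<zeta>" for v \<zeta>
  proof -
    have "v \<noteq> 0" "\<zeta> \<noteq> 0" using that by auto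
    then show ?thesis
      by (simp add: powr_def) (simp only: Ln_mult_Re_pos[OF that] distrib_left exp_add minus_add_distrib)
  qed
  show "continuous_on {v. 0 < Re v} (\<lambda>v. v powr - complex_of_real c)"
    by (intro continuous_intros) (auto simp: complex_nonpos_Reals_iff)
qed

lemma inverse_power_cmod_powr: "inverse_power (\<lambda>v. of_real (cmod v powr - c)) c"
proof
  show "continuous_on {v. 0 < Re v} (\<lambda>v. complex_of_real (cmod v powr - c))"
    by (intro continuous_intros) auto
qed (auto simp: norm_mult powr_mult)

lemma kerT_eq_tker:
  "kerT e b1 b2 c1 c2 = tker (\<lambda>v. v powr - of_real c1) (\<lambda>v. v powr - of_real c2) e b1 b2"
  by (intro ext) (auto simp: kerT_def tker_def powr_minus field_simps split: prod.split)

lemma kerS_eq_tker: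
  "kerS e b1 b2 c1 c2 = tker (\<lambda>v. of_real (cmod v powr - c1)) (\<lambda>v. of_real (cmod v powr - c2)) e b1 b2"
  by (intro ext) (auto simp: kerS_def tker_def powr_minus field_simps split: prod.split)

theorem theorem6p2:
  fixes e :: "'n::finite"
    and q1 q2 a1 a2 b1 b2 c1 c2 \<alpha>1 \<alpha>2 \<beta>1 \<beta>2 :: real
  assumes "q1 \<ge> 1" and "q2 \<ge> 1"
    and "\<alpha>1 > -1" and "\<alpha>2 > -1" and "\<beta>1 > -1" and "\<beta>2 > -1"
  shows "(bounded_op e a1 a2 (kerS e b1 b2 c1 c2) 1 1 \<alpha>1 \<alpha>2 q1 q2 \<beta>1 \<beta>2
            \<longleftrightarrow> bounded_op e a1 a2 (kerT e b1 b2 c1 c2) 1 1 \<alpha>1 \<alpha>2 q1 q2 \<beta>1 \<beta>2)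
       \<and> (bounded_op e a1 a2 (kerT e b1 b2 c1 c2) 1 1 \<alpha>1 \<alpha>2 q1 q2 \<beta>1 \<beta>2
            \<longleftrightarrow> (- q1 * a1 < \<beta>1 + 1 \<and> \<alpha>1 < b1 \<and>
                 c1 = real CARD('n) + 1 + a1 + b1
                      + ((real CARD('n) + 1 + \<beta>1) / q1 - (real CARD('n) + 1 + \<alpha>1)) \<and>
                 - q2 * a2 < \<beta>2 + 1 \<and> \<alpha>2 < b2 \<and>
                 c2 = real CARD('n) + 1 + a2 + b2
                      + ((real CARD('n) + 1 + \<beta>2) / q2 - (real CARD('n) + 1 + \<alpha>2))))"
proof -
  \<comment> \<open>The criterion depends on the inverse powers only through the exponents c1 and
    c2, so both instances give the same condition.\<close>
  interpret T: two_inverse_powers "\<lambda>v. v powr - of_real c1" c1 "\<lambda>v. v powr - of_real c2" c2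
    by (intro two_inverse_powers.intro inverse_power_powr)
  interpret S: two_inverse_powers "\<lambda>v. of_real (cmod v powr - c1)" c1 "\<lambda>v. of_real (cmod v powr - c2)" c2
    by (intro two_inverse_powers.intro inverse_power_cmod_powr)
  show ?thesis
    unfolding kerT_eq_tker kerS_eq_tker
    using T.bounded_op_iff[OF assms(1,2)] S.bounded_op_iff[OF assms(1,2)] by blast
qed

end
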